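(* Let $\mathbb{F}$ be an algebraically closed field and let $0\neq q\in\mathbb{F}$ be not a root of unity. Let $\mathcal{V}$ be a feasible $\hat{H}_q$-module. Then the pair $\mathbb{A},\mathbb{B}$ acts on each eigenspace of $t_0$ on $\mathcal{V}$ as a Leonard pair of $q$-Racah type.
   Context: $\hat{H}_q$ (the universal DAHA of type $(C_1^\vee,C_1)$) is the associative unital $\mathbb{F}$-algebra with generators $t_i^{\pm1}$ ($i\in\{0,1,2,3\}$) and relations: $t_it_i^{-1}=t_i^{-1}t_i=1$; $t_i+t_i^{-1}$ is central; $t_0t_1t_2t_3=q^{-1}$. Put $X=t_3t_0$, $Y=t_0t_1$, $\mathbb{A}=Y+Y^{-1}$, $\mathbb{B}=X+X^{-1}$. The elements $\mathbb{A},\mathbb{B}$ commute with $t_0$, so each eigenspace of $t_0$ is invariant under $\mathbb{A},\mathbb{B}$. An $\hat{H}_q$-module is feasible if it is finite-dimensional and irreducible, both $X$ and $Y$ are diagonalizable on it, and $t_0$ has two distinct eigenvalues on it. A tridiagonal matrix is irreducible if all its subdiagonal and superdiagonal entries are nonzero. A Leonard pair on a vector space $V$ of finite positive dimension is an ordered pair of linear maps $A,A^*:V\to V$ such that (i) there is a basis of $V$ in which $A$ is irreducible tridiagonal and $A^*$ is diagonal; (ii) there is a basis of $V$ in which $A^*$ is irreducible tridiagonal and $A$ is diagonal. Its diameter is $d=\dim V-1$. Both $A$ and $A^*$ have $d+1$ distinct eigenvalues. An ordering $\{\theta_r\}_{r=0}^d$ of the eigenvalues of $A$ is standard if the corresponding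 ordered basis of eigenvectors of $A$ satisfies (ii); similarly for $A^*$ with (i). If $\{\theta_r\}_{r=0}^d$ is standard, then the only other standard ordering is $\{\theta_{d-r}\}_{r=0}^d$. A sequence $\{\theta_r\}_{r=0}^d$ is $q$-Racah if there is $0\ne\alpha\in\mathbb{F}$ with $\theta_r=\alpha q^{2r-d}+\alpha^{-1}q^{d-2r}$ for $0\le r\le d$. The Leonard pair has $q$-Racah type if for each of $A,A^*$ a standard ordering of the eigenvalues is a $q$-Racah sequence. *)

theory Defs
  imports Complex_Main "HOL-Library.Poly_Mapping" "HOL-Computational_Algebra.Polynomial"
    "HOL-Algebra.QuotRing"
begin

text \<open>
  The free associative unital algebra on the eight letters \<open>t\<^sub>i\<close>, \<open>t\<^sub>i\<inverse>\<close> is the monoid algebra of the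
  free monoid of words. The wrapper \<open>Word\<close> makes concatenation the additive operation, so that the
  convolution product of \<open>HOL-Library.Poly_Mapping\<close> is the (noncommutative) product of the algebra.
\<close>

datatype daha_index = I0 | I1 | I2 | I3

datatype daha_letter = Gen daha_index | GenInv daha_index

datatype daha_word = Word (letters: "daha_letter list")

instantiation daha_word :: monoid_add
begin

definition "0 = Word []"

definition "u + v = Word (letters u @ letters v)"

instance
  by standard (simp_all add: zero_daha_word_def plus_daha_word_def)

end

type_synonym 'f daha_free = "daha_word \<Rightarrow>\<^sub>0 'f"

definition free_alg :: "('f::field) daha_free ring" where
  "free_alg = \<lparr>carrier = UNIV, mult = (*), one = 1, zero = 0, add = (+)\<rparr>"

definition free_const :: "'f::field \<Rightarrow> 'f daha_free" where
  "free_const c = Poly_Mapping.single 0 c"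

definition free_gen :: "daha_index \<Rightarrow> ('f::field) daha_free" where
  "free_gen i = Poly_Mapping.single (Word [Gen i]) 1"

definition free_gen_inv :: "daha_index \<Rightarrow> ('f::field) daha_free" where
  "free_gen_inv i = Poly_Mapping.single (Word [GenInv i]) 1"

definition daha_relations :: "'f::field \<Rightarrow> 'f daha_free set" where
  "daha_relations q =
     {free_gen i * free_gen_inv i - 1 | i. True} \<union>
     {free_gen_inv i * free_gen i - 1 | i. True} \<union>
     {(free_gen i + free_gen_inv i) * x - x * (free_gen i + free_gen_inv i) | i x. True} \<union>
     {free_gen I0 * free_gen I1 * free_gen I2 * free_gen I3 - free_const (inverse q)}"

text \<open>
  \<open>Idl\<close> is the two-sided ideal generated by a set. The elements of \<open>DAHA q\<close> are the cosets of that ideal.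
\<close>

definition daha_ideal :: "'f::field \<Rightarrow> 'f daha_free set" where
  "daha_ideal q = Idl\<^bsub>free_alg\<^esub> (daha_relations q)"

definition DAHA :: "'f::field \<Rightarrow> ('f daha_free set) ring" where
  "DAHA q = free_alg Quot daha_ideal q"

lemma ring_free_alg: "ring (free_alg :: ('f::field) daha_free ring)"
proof (rule ringI)
  show "abelian_group (free_alg :: 'f daha_free ring)"
    by (rule abelian_groupI)
      (auto simp: free_alg_def algebra_simps intro!: exI[of _ "- x" for x])
  show "Group.monoid (free_alg :: 'f daha_free ring)"
    by (rule monoidI) (auto simp: free_alg_def algebra_simps)
qed (auto simp: free_alg_def algebra_simps)

lemma ideal_daha_ideal: "ideal (daha_ideal q) free_alg"
  unfolding daha_ideal_def
  by (rule ring.genideal_ideal[OF ring_free_alg]) (simp add: free_alg_def)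

lemma ring_DAHA: "ring (DAHA q)"
  unfolding DAHA_def by (rule ideal.quotient_is_ring[OF ideal_daha_ideal])

definition daha_class :: "'f::field \<Rightarrow> 'f daha_free \<Rightarrow> 'f daha_free set" where
  "daha_class q x = daha_ideal q +>\<^bsub>free_alg\<^esub> x"

definition daha_const :: "'f::field \<Rightarrow> 'f \<Rightarrow> 'f daha_free set" where
  "daha_const q c = daha_class q (free_const c)"

definition daha_t :: "'f::field \<Rightarrow> daha_index \<Rightarrow> 'f daha_free set" where
  "daha_t q i = daha_class q (free_gen i)"

definition daha_X :: "'f::field \<Rightarrow> 'f daha_free set" where
  "daha_X q = daha_t q I3 \<otimes>\<^bsub>DAHA q\<^esub> daha_t q I0"

definition daha_Y :: "'f::field \<Rightarrow> 'f daha_free set" where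
  "daha_Y q = daha_t q I0 \<otimes>\<^bsub>DAHA q\<^esub> daha_t q I1"

definition daha_A :: "'f::field \<Rightarrow> 'f daha_free set" where
  "daha_A q = daha_Y q \<oplus>\<^bsub>DAHA q\<^esub> inv\<^bsub>DAHA q\<^esub> daha_Y q"

definition daha_B :: "'f::field \<Rightarrow> 'f daha_free set" where
  "daha_B q = daha_X q \<oplus>\<^bsub>DAHA q\<^esub> inv\<^bsub>DAHA q\<^esub> daha_X q"

definition q_Racah_seq :: "'f::field \<Rightarrow> nat \<Rightarrow> (nat \<Rightarrow> 'f) \<Rightarrow> bool" where
  "q_Racah_seq q d \<theta> \<longleftrightarrow>
     (\<exists>\<alpha>. \<alpha> \<noteq> 0 \<and>
       (\<forall>r\<le>d. \<theta> r = \<alpha> * q powi (2 * int r - int d) + inverse \<alpha> * q powi (int d - 2 * int r)))"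

text \<open>Matrices below are indexed by \<open>{0..d}\<close>; entries outside this range are irrelevant.\<close>

definition irred_tridiagonal :: "nat \<Rightarrow> (nat \<Rightarrow> nat \<Rightarrow> 'f::zero) \<Rightarrow> bool" where
  "irred_tridiagonal d M \<longleftrightarrow>
     (\<forall>i\<le>d. \<forall>j\<le>d. (i + 1 < j \<or> j + 1 < i) \<longrightarrow> M i j = 0) \<and>
     (\<forall>i<d. M (i + 1) i \<noteq> 0 \<and> M i (i + 1) \<noteq> 0)"

definition diagonal_matrix :: "nat \<Rightarrow> (nat \<Rightarrow> nat \<Rightarrow> 'f::zero) \<Rightarrow> bool" where
  "diagonal_matrix d M \<longleftrightarrow> (\<forall>i\<le>d. \<forall>j\<le>d. i \<noteq> j \<longrightarrow> M i j = 0)"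

text \<open>
  The prefix \<open>local\<close> is needed because \<open>real_vector\<close> is a global interpretation of
  \<open>vector_space\<close> whose constants would otherwise shadow the ones defined here.
\<close>

context vector_space
begin

definition eigenspace :: "('b \<Rightarrow> 'b) \<Rightarrow> 'a \<Rightarrow> 'b set" where
  "eigenspace f c = {v. f v = c *s v}"

definition eigenvalues_on :: "'b set \<Rightarrow> ('b \<Rightarrow> 'b) \<Rightarrow> 'a set" where
  "eigenvalues_on W f = {c. \<exists>v\<in>W. v \<noteq> 0 \<and> f v = c *s v}"

definition diagonalizable :: "('b \<Rightarrow> 'b) \<Rightarrow> bool" where
  "diagonalizable f \<longleftrightarrow>
     (\<exists>S. independent S \<and> span S = UNIV \<and> (\<forall>b\<in>S. \<exists>c. f b = c *s b))"

definition endo_on :: "'b set \<Rightarrow> ('b \<Rightarrow> 'b) \<Rightarrow> bool" where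
  "endo_on W f \<longleftrightarrow>
     f ` W \<subseteq> W \<and> (\<forall>x\<in>W. \<forall>y\<in>W. f (x + y) = f x + f y) \<and> (\<forall>c. \<forall>x\<in>W. f (c *s x) = c *s f x)"

definition ordered_basis :: "'b set \<Rightarrow> nat \<Rightarrow> (nat \<Rightarrow> 'b) \<Rightarrow> bool" where
  "ordered_basis W d v \<longleftrightarrow>
     inj_on v {..d} \<and> independent (v ` {..d}) \<and> span (v ` {..d}) = W"

definition represents :: "nat \<Rightarrow> (nat \<Rightarrow> 'b) \<Rightarrow> ('b \<Rightarrow> 'b) \<Rightarrow> (nat \<Rightarrow> nat \<Rightarrow> 'a) \<Rightarrow> bool" where
  "represents d v f M \<longleftrightarrow> (\<forall>j\<le>d. f (v j) = (\<Sum>i\<le>d. M i j *s v i))"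

text \<open>\<open>f\<close> is irreducible tridiagonal and \<open>g\<close> is diagonal in the basis \<open>v\<close>.\<close>

definition tridiag_diag_basis ::
    "'b set \<Rightarrow> nat \<Rightarrow> ('b \<Rightarrow> 'b) \<Rightarrow> ('b \<Rightarrow> 'b) \<Rightarrow> (nat \<Rightarrow> 'b) \<Rightarrow> bool" where
  "tridiag_diag_basis W d f g v \<longleftrightarrow>
     local.ordered_basis W d v \<and>
     (\<exists>M. local.represents d v f M \<and> irred_tridiagonal d M) \<and>
     (\<exists>D. local.represents d v g D \<and> diagonal_matrix d D)"

definition diameter :: "'b set \<Rightarrow> nat" where
  "diameter W = dim W - 1"

definition Leonard_pair :: "'b set \<Rightarrow> ('b \<Rightarrow> 'b) \<Rightarrow> ('b \<Rightarrow> 'b) \<Rightarrow> bool" where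
  "Leonard_pair W f g \<longleftrightarrow>
     subspace W \<and> (\<exists>S. finite S \<and> span S = W) \<and> 0 < dim W \<and>
     local.endo_on W f \<and> local.endo_on W g \<and>
     (\<exists>v. local.tridiag_diag_basis W (local.diameter W) f g v) \<and>
     (\<exists>v. local.tridiag_diag_basis W (local.diameter W) g f v)"

text \<open>
  An ordering of the eigenvalues of \<open>g\<close> is standard for the pair \<open>f\<close>, \<open>g\<close> if \<open>f\<close> is irreducible
  tridiagonal in a corresponding basis of eigenvectors of \<open>g\<close>. (Corresponding bases differ only by
  nonzero scalings of the vectors, which preserve this property.)
\<close>

definition standard_ordering :: "'b set \<Rightarrow> ('b \<Rightarrow> 'b) \<Rightarrow> ('b \<Rightarrow> 'b) \<Rightarrow> (nat \<Rightarrow> 'a) \<Rightarrow> bool" where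
  "standard_ordering W f g \<theta> \<longleftrightarrow>
     bij_betw \<theta> {..local.diameter W} (local.eigenvalues_on W g) \<and>
     (\<exists>v. local.tridiag_diag_basis W (local.diameter W) f g v \<and>
       (\<forall>r\<le>local.diameter W. g (v r) = \<theta> r *s v r))"

definition q_Racah_type :: "'a \<Rightarrow> 'b set \<Rightarrow> ('b \<Rightarrow> 'b) \<Rightarrow> ('b \<Rightarrow> 'b) \<Rightarrow> bool" where
  "q_Racah_type q W f g \<longleftrightarrow>
     (\<exists>\<theta>. local.standard_ordering W g f \<theta> \<and> q_Racah_seq q (local.diameter W) \<theta>) \<and>
     (\<exists>\<theta>. local.standard_ordering W f g \<theta> \<and> q_Racah_seq q (local.diameter W) \<theta>)"

end

text \<open>
  A left module over the algebra \<open>DAHA q\<close>, on the vector space carried by the whole type \<open>'v\<close>.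
\<close>

locale DAHA_module = vector_space scale
  for scale :: "'f::field \<Rightarrow> 'v::ab_group_add \<Rightarrow> 'v" (infixr \<open>*s\<close> 75) +
  fixes q :: 'f
    and act :: "'f daha_free set \<Rightarrow> 'v \<Rightarrow> 'v"
  assumes act_add_right: "h \<in> carrier (DAHA q) \<Longrightarrow> act h (v + w) = act h v + act h w"
    and act_scale: "h \<in> carrier (DAHA q) \<Longrightarrow> act h (c *s v) = c *s act h v"
    and act_add: "h \<in> carrier (DAHA q) \<Longrightarrow> k \<in> carrier (DAHA q) \<Longrightarrow>
      act (h \<oplus>\<^bsub>DAHA q\<^esub> k) v = act h v + act k v"
    and act_mult: "h \<in> carrier (DAHA q) \<Longrightarrow> k \<in> carrier (DAHA q) \<Longrightarrow>
      act (h \<otimes>\<^bsub>DAHA q\<^esub> k) v = act h (act k v)"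
    and act_one: "act \<one>\<^bsub>DAHA q\<^esub> v = v"
    and act_const: "act (daha_const q c) v = c *s v"
begin

definition irreducible_module :: bool where
  "irreducible_module \<longleftrightarrow>
     (\<exists>v::'v. v \<noteq> 0) \<and>
     (\<forall>W. subspace W \<and> (\<forall>h\<in>carrier (DAHA q). act h ` W \<subseteq> W) \<longrightarrow> W = {0} \<or> W = UNIV)"

end

locale feasible_DAHA_module = DAHA_module +
  assumes finite_dim: "\<exists>S. finite S \<and> span S = UNIV"
    and irreducible: "irreducible_module"
    and diagonalizable_X: "diagonalizable (act (daha_X q))"
    and diagonalizable_Y: "diagonalizable (act (daha_Y q))"
    and two_eigenvalues: "card (eigenvalues_on UNIV (act (daha_t q I0))) = 2"

end

theory Submission
  imports Defs
begin

text \<open>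
  By Schur's lemma each \<open>t\<^sub>i + t\<^sub>i\<inverse>\<close> acts as a scalar. The defining relations then show that \<open>t\<^sub>0\<close> maps
  the \<open>\<mu>\<close>-eigenspace of \<open>X\<close> into the sum of the eigenspaces for \<open>\<mu>\<close> and \<open>\<mu>\<inverse>\<close>, and that \<open>t\<^sub>1\<close> maps it into
  the sum of those for \<open>\<mu>\<close> and \<open>q\<^sup>-\<^sup>2 \<mu>\<inverse>\<close>. Applying \<open>t\<^sub>0\<close> and \<open>t\<^sub>1\<close> alternately to an eigenvector at one end
  of the resulting path of eigenvalues produces, after subtracting multiples of the previous vector,
  a chain of eigenvectors of \<open>X\<close> with distinct eigenvalues; by irreducibility it is a basis of the
  module. The operator \<open>t\<^sub>0\<close> is block diagonal with blocks of size at most two along this chain, and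
  each block meets the eigenspace of \<open>t\<^sub>0\<close> in dimension at most one. This gives a basis of the
  eigenspace in which \<open>X + X\<inverse>\<close> is diagonal with a \<open>q\<close>-Racah spectrum and \<open>Y + Y\<inverse>\<close>, which
  differs from \<open>t\<^sub>1\<close> followed by a multiple of the projection onto the eigenspace only by a scalar,
  is irreducible tridiagonal. The substitution \<open>t\<^sub>0, t\<^sub>1, t\<^sub>2, t\<^sub>3, q \<mapsto> t\<^sub>0\<inverse>, t\<^sub>3\<inverse>, t\<^sub>2\<inverse>, t\<^sub>1\<inverse>, q\<inverse>\<close>
  preserves the relations and exchanges the two operators.
\<close>

section \<open>Eigenvectors in abstract vector spaces\<close>

context vector_space
begin

text \<open>Applying \<open>f - l j\<close> to the relation removes the summand of \<open>j\<close>
  and multiplies the others by nonzero scalars. The \<open>x i\<close> may be zero, so coefficients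
  can be absorbed into them.\<close>

lemma eigenvectors_sum_zeroD:
  assumes "Vector_Spaces.linear scale scale f" "finite I" "inj_on l I"
    and "\<And>i. i \<in> I \<Longrightarrow> f (x i) = l i *s x i" "(\<Sum>i\<in>I. x i) = 0" "i \<in> I"
  shows "x i = 0"
  using assms(2-)
proof (induction I arbitrary: x i rule: finite_induct)
  case (insert j I)
  interpret f: Vector_Spaces.linear scale scale f by (rule assms(1))
  have "(\<Sum>i\<in>insert j I. l i *s x i) = f (\<Sum>i\<in>insert j I. x i)"
    unfolding f.sum using insert.prems(2) by (intro sum.cong) auto
  also have "\<dots> = l j *s (\<Sum>i\<in>insert j I. x i)"
    using insert.prems(3) by (simp add: f.zero)
  finally have "(\<Sum>i\<in>insert j I. (l i - l j) *s x i) = 0"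
    by (simp add: scale_left_diff_distrib sum_subtractf scale_sum_right)
  then have *: "(\<Sum>i\<in>I. (l i - l j) *s x i) = 0"
    using insert.hyps by simp
  have "(l i - l j) *s x i = 0" if "i \<in> I" for i
    using insert.prems(1,2) insert.IH[OF _ _ * that]
    by (simp add: f.scale scale_left_commute)
  moreover have "l i \<noteq> l j" if "i \<in> I" for i
    using inj_onD[OF insert.prems(1), of i j] insert.hyps(2) that by auto
  ultimately have "x i = 0" if "i \<in> I" for i
    using that by auto
  with insert.prems(3,4) insert.hyps show ?case
    by auto
qed simp

lemma eigenvectors_independent:
  assumes "Vector_Spaces.linear scale scale f" "finite I" "inj_on l I"
    and "\<And>i. i \<in> I \<Longrightarrow> f (x i) = l i *s x i" "\<And>i. i \<in> I \<Longrightarrow> x i \<noteq> 0"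
  shows "inj_on x I" "independent (x ` I)"
proof -
  interpret f: Vector_Spaces.linear scale scale f by (rule assms(1))
  show inj: "inj_on x I"
  proof (rule inj_onI)
    fix i j assume *: "i \<in> I" "j \<in> I" "x i = x j"
    then have "l i *s x i = l j *s x i"
      using assms(4)[of i] assms(4)[of j] by metis
    then show "i = j"
      using * inj_onD[OF assms(3)] assms(5)[of i] by auto
  qed
  show "independent (x ` I)"
  proof (rule independent_if_scalars_zero)
    fix u y assume "(\<Sum>y\<in>x ` I. u y *s y) = 0" "y \<in> x ` I"
    then obtain i where i: "i \<in> I" "y = x i" and *: "(\<Sum>i\<in>I. u (x i) *s x i) = 0"
      using inj by (auto simp: sum.reindex)
    have "u (x i) *s x i = 0"
      using eigenvectors_sum_zeroD[OF assms(1-3) _ * i(1)] assms(4)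
      by (simp add: f.scale scale_left_commute)
    then show "u y = 0"
      using i assms(5) by simp
  qed (use assms(2) in simp)
qed

text \<open>The source of termination: a sequence of candidate eigenvectors for distinct eigenvalues
  must reach zero.\<close>

lemma not_infinite_eigenvectors:
  assumes "Vector_Spaces.linear scale scale f" "finite S" "span S = UNIV" "inj (l :: nat \<Rightarrow> 'a)"
  shows "\<exists>n. f (x n) = l n *s x n \<longrightarrow> x n = 0"
proof (rule ccontr)
  assume "\<not> ?thesis"
  then have x: "f (x n) = l n *s x n" "x n \<noteq> 0" for n
    by auto
  let ?I = "{..card S}"
  have "inj_on l ?I"
    using assms(4) by (rule inj_on_subset) simp
  note ind = eigenvectors_independent[OF assms(1) _ this x(1) x(2), simplified]
  have "card (x ` ?I) \<le> card S"
    using independent_span_bound[OF assms(2) ind(2)] assms(3) by simp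
  then show False
    using ind(1) by (simp add: card_image)
qed

lemma eigenvalues_on_span_eigenvectors:
  assumes "Vector_Spaces.linear scale scale f" "finite I" "inj_on l I"
    and "\<And>i. i \<in> I \<Longrightarrow> f (x i) = l i *s x i" "\<And>i. i \<in> I \<Longrightarrow> x i \<noteq> 0"
  shows "eigenvalues_on (span (x ` I)) f = l ` I"
proof (intro equalityI subsetI)
  interpret f: Vector_Spaces.linear scale scale f by (rule assms(1))
  fix c assume "c \<in> eigenvalues_on (span (x ` I)) f"
  then obtain v where v: "v \<in> span (x ` I)" "v \<noteq> 0" "f v = c *s v"
    unfolding eigenvalues_on_def by auto
  note ind = eigenvectors_independent[OF assms]
  have "v \<in> range (\<lambda>u. \<Sum>y\<in>x ` I. u y *s y)"
    using v(1) assms(2) by (simp add: span_finite)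
  then obtain u where "v = (\<Sum>y\<in>x ` I. u y *s y)"
    by blast
  then have u: "v = (\<Sum>i\<in>I. u (x i) *s x i)"
    using ind(1) by (simp add: sum.reindex)
  have "f v = (\<Sum>i\<in>I. u (x i) *s l i *s x i)"
    unfolding u f.sum f.scale using assms(4) by (intro sum.cong) auto
  then have "(\<Sum>i\<in>I. u (x i) *s l i *s x i) - c *s (\<Sum>i\<in>I. u (x i) *s x i) = 0"
    using v(3) u by simp
  then have *: "(\<Sum>i\<in>I. (l i - c) *s u (x i) *s x i) = 0"
    by (simp add: scale_sum_right sum_subtractf scale_left_diff_distrib left_diff_distrib mult.commute[of _ "l _"])
  have "(l i - c) *s u (x i) *s x i = 0" if "i \<in> I" for i
    using assms(4) by (intro eigenvectors_sum_zeroD[OF assms(1-3) _ * that])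
      (simp add: f.scale scale_left_commute)
  then have "c \<in> l ` I \<or> (\<forall>i\<in>I. u (x i) *s x i = 0)"
    by auto
  then show "c \<in> l ` I"
    using v(2) unfolding u by (metis (mono_tags, lifting) sum.neutral)
next
  fix c assume "c \<in> l ` I"
  then show "c \<in> eigenvalues_on (span (x ` I)) f"
    using assms(4,5) unfolding eigenvalues_on_def by (force intro: span_base)
qed

lemma diagonalizable_generalized_eigenvector:
  assumes "Vector_Spaces.linear scale scale f" "diagonalizable f"
    and "f (f v - c *s v) = c *s (f v - c *s v)"
  shows "f v = c *s v"
proof -
  interpret f: Vector_Spaces.linear scale scale f by (rule assms(1))
  obtain S where S: "independent S" "span S = UNIV" "\<And>b. b \<in> S \<Longrightarrow> \<exists>c. f b = c *s b"
    using assms(2) unfolding diagonalizable_def by blast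
  then obtain l where l: "\<And>b. b \<in> S \<Longrightarrow> f b = l b *s b"
    by metis
  obtain r t where t: "finite t" "t \<subseteq> S" "v = (\<Sum>b\<in>t. r b *s b)"
    using S(2) UNIV_I[of v] unfolding S(2)[symmetric] span_explicit by blast
  have fv: "f (\<Sum>b\<in>t. u b *s b) - c *s (\<Sum>b\<in>t. u b *s b) = (\<Sum>b\<in>t. (u b * (l b - c)) *s b)" for u
  proof -
    have "f (\<Sum>b\<in>t. u b *s b) = (\<Sum>b\<in>t. (u b * l b) *s b)"
      unfolding f.sum f.scale using l t(2) by (intro sum.cong) auto
    then show ?thesis
      by (simp add: scale_sum_right sum_subtractf scale_left_diff_distrib right_diff_distrib mult.commute)
  qed
  have "(\<Sum>b\<in>t. (r b * (l b - c) * (l b - c)) *s b) = 0"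
    using assms(3) unfolding t(3) fv by (simp add: fv[symmetric])
  then have "r b * (l b - c) * (l b - c) = 0" if "b \<in> t" for b
    using independentD[OF S(1) t(1,2) _ that, of "\<lambda>b. r b * (l b - c) * (l b - c)"] by blast
  then have "(\<Sum>b\<in>t. (r b * (l b - c)) *s b) = 0"
    by (intro sum.neutral) auto
  then show ?thesis
    using fv[of r] t(3) by simp
qed

end

text \<open>Take \<open>p\<close> of least degree with \<open>p(f) v = 0\<close> and a root
  \<open>c\<close> of it. For \<open>p = (x - c) r\<close> the vector \<open>r(f) v\<close> is
  nonzero by minimality and is killed by \<open>f - c\<close>.\<close>

lemma exists_eigenvector:
  fixes scale :: "'f::alg_closed_field \<Rightarrow> 'v::ab_group_add \<Rightarrow> 'v"
  assumes "Vector_Spaces.linear scale scale f" "finite S" "module.span scale S = UNIV" "(v::'v) \<noteq> 0"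
  shows "\<exists>c w. w \<noteq> 0 \<and> f w = scale c w"
proof -
  interpret f: Vector_Spaces.linear scale scale f by (rule assms(1))
  \<comment> \<open>Horner evaluation of \<open>p(f) v\<close>.\<close>
  define ev where "ev p = fold_coeffs (\<lambda>a y. scale a v + f y) p 0" for p
  have ev_0 [simp]: "ev 0 = 0"
    by (simp add: ev_def)
  have ev_pCons [simp]: "ev (pCons a p) = scale a v + f (ev p)" for a p
    by (cases "p = 0 \<and> a = 0") (auto simp: ev_def f.zero)
  have ev_add: "ev (p + r) = ev p + ev r" for p r
    by (induction p r rule: poly_induct2) (simp_all add: f.vs1.scale_left_distrib f.add)
  have ev_smult: "ev (smult c p) = scale c (ev p)" for c p
    by (induction p) (simp_all add: f.vs1.scale_right_distrib f.scale)
  have ev_sum: "ev (sum p A) = (\<Sum>i\<in>A. ev (p i))" if "finite A" for p and A :: "nat set"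
    using that by induction (simp_all add: ev_add)
  have ev_monom: "ev (monom c i) = scale c (ev (monom 1 i))" for c i
    using ev_smult[of c "monom 1 i"] by (simp add: smult_monom)
  have "\<exists>p. p \<noteq> 0 \<and> ev p = 0"
  proof (cases "inj (\<lambda>i. ev (monom 1 i))")
    case False
    then obtain i j where ij: "i \<noteq> j" "ev (monom 1 i) = ev (monom 1 j)"
      by (auto simp: inj_def)
    have "coeff (monom 1 i + smult (-1) (monom 1 j) :: 'f poly) i = 1"
      using ij(1) by simp
    then have "monom 1 i + smult (-1) (monom 1 j) \<noteq> (0 :: 'f poly)"
      by (metis coeff_0 zero_neq_one)
    moreover have "ev (monom 1 i + smult (-1) (monom 1 j)) = 0"
      unfolding ev_add ev_smult using ij(2) by simp
    ultimately show ?thesis by blast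
  next
    case inj: True
    let ?I = "{..card S}"
    have inj': "inj_on (\<lambda>i. ev (monom 1 i)) ?I"
      using inj by (rule inj_on_subset) simp
    have "f.vs1.dependent ((\<lambda>i. ev (monom 1 i)) ` ?I)"
      using f.vs1.independent_span_bound[OF assms(2), of "(\<lambda>i. ev (monom 1 i)) ` ?I"] assms(3)
      by (auto simp: card_image[OF inj'])
    then obtain u y where u: "y \<in> (\<lambda>i. ev (monom 1 i)) ` ?I" "u y \<noteq> 0"
      "(\<Sum>y\<in>(\<lambda>i. ev (monom 1 i)) ` ?I. scale (u y) y) = 0"
      using f.vs1.dependent_finite[of "(\<lambda>i. ev (monom 1 i)) ` ?I"] by auto
    from u(1,2) obtain j where j: "j \<in> ?I" "u (ev (monom 1 j)) \<noteq> 0" by auto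
    define p where "p = (\<Sum>i\<in>?I. monom (u (ev (monom 1 i))) i)"
    have "coeff p j = u (ev (monom 1 j))"
      using j(1) by (simp add: p_def coeff_sum sum.delta)
    then have "p \<noteq> 0"
      using j(2) by auto
    moreover have "ev p = (\<Sum>i\<in>?I. scale (u (ev (monom 1 i))) (ev (monom 1 i)))"
      unfolding p_def by (subst ev_sum, simp, rule sum.cong[OF refl], rule ev_monom)
    then have "ev p = 0"
      using u(3) inj' by (simp add: sum.reindex)
    ultimately show ?thesis by blast
  qed
  then obtain p0 where "p0 \<noteq> 0 \<and> ev p0 = 0" ..
  from ex_has_least_nat[of "\<lambda>p. p \<noteq> 0 \<and> ev p = 0", OF this, of degree]
  obtain p where p: "p \<noteq> 0" "ev p = 0" "\<And>r. r \<noteq> 0 \<and> ev r = 0 \<Longrightarrow> degree p \<le> degree r"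
    by blast
  have "degree p \<noteq> 0"
  proof
    assume "degree p = 0"
    then obtain a where "p = [:a:]"
      using degree_eq_zeroE by blast
    with p(1,2) assms(4) show False
      by (simp add: f.zero)
  qed
  then obtain c where "poly p c = 0"
    using alg_closed_imp_poly_has_root by blast
  then obtain r where r: "p = [:-c, 1:] * r"
    unfolding poly_eq_0_iff_dvd by (auto elim: dvdE)
  then have "r \<noteq> 0" "degree p = Suc (degree r)"
    using p(1) by (auto simp: degree_mult_eq simp del: mult_pCons_left)
  then have "ev r \<noteq> 0"
    using p(3)[of r] by auto
  moreover have "ev p = f (ev r) - scale c (ev r)"
    unfolding r mult_pCons_left ev_add ev_smult by (simp add: ev_smult f.vs1.scale_minus_left)
  ultimately show ?thesis
    using p(2) by auto
qed

section \<open>Intertwiners between eigenspaces of \<open>X\<close>\<close>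

text \<open>\<open>X\<close> stands for \<open>t3 t0\<close>, \<open>X'\<close> for its inverse,
  each \<open>Ti\<close> for the scalar \<open>ti + ti^-1\<close>. The relations are stated without
  \<open>t2\<close> and \<open>t3\<close>, so that the locale applies a second time to the inverses
  \<open>s0\<close>, \<open>s3\<close> with \<open>s1 s0\<close> as \<open>X\<close>.\<close>

locale XT_operators = vector_space scale
  for scale :: "'f::alg_closed_field \<Rightarrow> 'v::ab_group_add \<Rightarrow> 'v" (infixr \<open>*s\<close> 75) +
  fixes q T0 T1 T2 T3 :: 'f and t0 t1 X X' :: "'v \<Rightarrow> 'v"
  assumes q_nonzero: "q \<noteq> 0"
    and q_not_root: "\<And>n::nat. n > 0 \<Longrightarrow> q ^ n \<noteq> 1"
    and linear_t0: "Vector_Spaces.linear scale scale t0"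
    and linear_t1: "Vector_Spaces.linear scale scale t1"
    and linear_X: "Vector_Spaces.linear scale scale X"
    and linear_X': "Vector_Spaces.linear scale scale X'"
    and X_X': "X (X' v) = v" and X'_X: "X' (X v) = v"
    and t0_t0: "t0 (t0 v) = T0 *s t0 v - v"
    and t1_t1: "t1 (t1 v) = T1 *s t1 v - v"
    and X_t0: "X (t0 v) = t0 (X' v) + T0 *s X v - T3 *s v"
    and X_t1: "X (t1 v) = inverse (q\<^sup>2) *s t1 (X' v) + (T2 / q) *s v - (T1 / q\<^sup>2) *s X' v"
    and finite_span: "\<exists>S. finite S \<and> span S = UNIV"
    and nontrivial: "\<exists>v::'v. v \<noteq> 0"
    and irreducible: "\<And>W. subspace W \<Longrightarrow> t0 ` W \<subseteq> W \<Longrightarrow> t1 ` W \<subseteq> W \<Longrightarrow> X ` W \<subseteq> W \<Longrightarrow> X' ` W \<subseteq> W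
      \<Longrightarrow> W = {0} \<or> W = UNIV"
    and diagonalizable_X: "diagonalizable X"
begin

sublocale t0: Vector_Spaces.linear scale scale t0 by (rule linear_t0)
sublocale t1: Vector_Spaces.linear scale scale t1 by (rule linear_t1)
sublocale X: Vector_Spaces.linear scale scale X by (rule linear_X)
sublocale X': Vector_Spaces.linear scale scale X' by (rule linear_X')

lemmas scale_distribs = scale_left_distrib scale_right_distrib
  scale_left_diff_distrib scale_right_diff_distrib

section \<open>Alternation of \<open>t0\<close> and \<open>t1\<close> on eigenvectors of
  \<open>X\<close>\<close>

definition u :: "nat \<Rightarrow> 'v \<Rightarrow> 'v" where
  "u n = (if even n then t0 else t1)"

definition U :: "nat \<Rightarrow> 'f" where
  "U n = (if even n then T0 else T1)"

text \<open>The eigenvalue that \<open>u n\<close> links with \<mu>. For fixed \<open>n\<close> this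
  is an involution on nonzero values, so the same \<open>u n\<close> leads back.\<close>

definition opposite :: "nat \<Rightarrow> 'f \<Rightarrow> 'f" where
  "opposite n \<mu> = (if even n then inverse \<mu> else inverse (q\<^sup>2 * \<mu>))"

lemma linear_u: "Vector_Spaces.linear scale scale (u n)"
  by (simp add: u_def linear_t0 linear_t1)

sublocale u: Vector_Spaces.linear scale scale "u n" by (rule linear_u)

lemma u_Suc_Suc [simp]: "u (Suc (Suc n)) = u n"
  by (simp add: u_def)

lemma u_u: "u n (u n v) = U n *s u n v - v"
  by (simp add: u_def U_def t0_t0 t1_t1)

lemma eigenvalue_nonzero:
  assumes "X v = \<mu> *s v" "v \<noteq> 0"
  shows "\<mu> \<noteq> 0"
  using assms X'_X[of v] by (auto simp: X'.zero)

lemma X'_eigenvector: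
  assumes "X v = \<mu> *s v"
  shows "X' v = inverse \<mu> *s v"
proof (cases "v = 0")
  case False
  have "v = \<mu> *s X' v"
    using X'_X[of v] assms by (simp add: X'.scale)
  then have "inverse \<mu> *s v = inverse \<mu> *s \<mu> *s X' v"
    by simp
  then show ?thesis
    using eigenvalue_nonzero[OF assms False] by simp
qed (simp add: X'.zero)

text \<open>The scalar \<open>b\<close> depends only on \<open>n\<close> and \<mu>; this order of
  quantifiers later lets all chain coefficients be fixed before any vector is constructed.\<close>

lemma X_u_eigenvector:
  "\<exists>b. \<forall>v. X v = \<mu> *s v \<longrightarrow> X (u n v) = opposite n \<mu> *s u n v + b *s v"
proof (cases "even n")
  case True
  have "X (u n v) = opposite n \<mu> *s u n v + (T0 * \<mu> - T3) *s v" if "X v = \<mu> *s v" for v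
    using True X_t0[of v] that X'_eigenvector[OF that]
    by (simp add: u_def opposite_def t0.scale scale_distribs)
  then show ?thesis by blast
next
  case False
  have "X (u n v) = opposite n \<mu> *s u n v + (T2 / q - T1 / q\<^sup>2 * inverse \<mu>) *s v"
    if "X v = \<mu> *s v" for v
    using False X_t1[of v] that X'_eigenvector[OF that]
    by (simp add: u_def opposite_def t1.scale scale_distribs)
  then show ?thesis by blast
qed

lemma intertwiner:
  assumes "opposite n \<mu> \<noteq> \<mu>"
  shows "\<exists>c. \<forall>v. X v = \<mu> *s v \<longrightarrow> X (u n v - c *s v) = opposite n \<mu> *s (u n v - c *s v)"
proof -
  obtain b where b: "\<And>v. X v = \<mu> *s v \<Longrightarrow> X (u n v) = opposite n \<mu> *s u n v + b *s v"
    using X_u_eigenvector by blast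
  \<comment> \<open>On the span of \<open>v\<close> and \<open>u n v\<close> the operator
    \<open>X\<close> is triangular with diagonal entries \<mu> and \<open>opposite n \<mu>\<close>;
    this multiple of \<open>v\<close> diagonalizes it.\<close>
  define c where "c = b / (\<mu> - opposite n \<mu>)"
  have bc: "b = c * \<mu> - c * opposite n \<mu>"
    unfolding right_diff_distrib[symmetric] c_def using assms by simp
  have "X (u n v - c *s v) = opposite n \<mu> *s (u n v - c *s v)" if "X v = \<mu> *s v" for v
    using b[OF that] that by (simp add: X.diff X.scale bc scale_distribs mult.commute)
  then show ?thesis by blast
qed

text \<open>At a fold, diagonalizability of \<open>X\<close> makes its eigenspace invariant under \<open>u n\<close>.\<close>

lemma fold_eigenvector:
  assumes "opposite n \<mu> = \<mu>" "X v = \<mu> *s v" "v \<noteq> 0"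
  shows "\<exists>w \<kappa>. w \<noteq> 0 \<and> X w = \<mu> *s w \<and> u n w = \<kappa> *s w"
proof -
  obtain b where "X (u n v) = \<mu> *s u n v + b *s v"
    using X_u_eigenvector[of \<mu> n] assms(1,2) by auto
  then have "X (u n v) - \<mu> *s u n v = b *s v"
    by simp
  then have Xu: "X (u n v) = \<mu> *s u n v"
    using diagonalizable_generalized_eigenvector[OF linear_X diagonalizable_X, of "u n v" \<mu>] assms(2)
    by (simp add: X.scale scale_left_commute)
  \<comment> \<open>\<open>u n\<close> is a root of \<open>x^2 - U n x + 1\<close>, whose roots are
    \<kappa> and \<open>U n - \<kappa>\<close>. Hence \<open>u n v - \<kappa> v\<close> is zero or
    an eigenvector for the second root.\<close>
  have "\<exists>x. poly [:1, - U n, 1:] x = 0"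
    by (rule alg_closed_imp_poly_has_root) simp
  then obtain \<kappa> where "1 + \<kappa> * (\<kappa> - U n) = 0"
    by auto
  then have \<kappa>: "\<kappa> * (U n - \<kappa>) = 1"
    by (simp add: algebra_simps)
  show ?thesis
  proof (cases "u n v = \<kappa> *s v")
    case False
    let ?w = "u n v - \<kappa> *s v"
    have "u n ?w = (U n - \<kappa>) *s u n v - (\<kappa> * (U n - \<kappa>)) *s v"
      unfolding \<kappa> by (simp add: u.diff u.scale u_u scale_distribs)
    then have "u n ?w = (U n - \<kappa>) *s ?w"
      by (simp add: scale_distribs mult.commute algebra_simps)
    moreover have "X ?w = \<mu> *s ?w"
      using Xu assms(2) by (simp add: X.diff X.scale scale_distribs mult.commute)
    ultimately show ?thesis
      using False by (intro exI[of _ ?w]) auto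
  qed (use assms in blast)
qed

text \<open>In terms of \<open>w\<close> and \<open>w'\<close> the matrix of \<open>u n\<close> has
  trace \<open>U n\<close> and determinant 1. Its entry \<open>c * (U n - c) - 1\<close> decides
  whether \<open>u n\<close> leads back from \<open>w'\<close> to \<open>w\<close>.\<close>

lemma u_intertwiner:
  assumes "w' = u n w - c *s w"
  shows "u n w = c *s w + w'"
    and "u n w' = (U n - c) *s w' + (c * (U n - c) - 1) *s w"
proof -
  show "u n w = c *s w + w'"
    using assms by simp
  show "u n w' = (U n - c) *s w' + (c * (U n - c) - 1) *s w"
    unfolding assms by (simp add: u.diff u.scale u_u scale_distribs algebra_simps)
qed

text \<open>
  Eigenvalues along the path: \<open>u n\<close> leads from \<open>path \<nu> n\<close> to \<open>path \<nu> (n + 1)\<close>. The path starts at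
  index \<open>m \<in> {0, 1}\<close>, so that \<open>t\<^sub>0\<close> always pairs the indices \<open>2j\<close> and \<open>2j + 1\<close>.
\<close>

definition path :: "'f \<Rightarrow> nat \<Rightarrow> 'f" where
  "path \<nu> n = (if even n then \<nu> / q ^ n else q ^ (n - 1) / \<nu>)"

lemma path_Suc: "path \<nu> (Suc n) = opposite n (path \<nu> n)"
proof (cases "even n")
  case False
  then obtain k where "n = Suc (2 * k)" by (auto elim: oddE)
  then show ?thesis
    by (simp add: path_def opposite_def field_simps power2_eq_square)
qed (simp add: path_def opposite_def)

lemma q_power_inj: "q ^ a = q ^ b \<longleftrightarrow> a = b"
proof -
  have "a = b" if "q ^ a = q ^ b" "a \<le> b" for a b
  proof -
    have "q ^ b = q ^ a * q ^ (b - a)"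
      using that(2) by (simp flip: power_add)
    then have "q ^ (b - a) = 1"
      using that(1) q_nonzero by simp
    then show ?thesis
      using q_not_root[of "b - a"] that(2) by (cases "b - a = 0") auto
  qed
  then show ?thesis
    by (metis nat_le_linear)
qed

text \<open>Values at indices of different parity \<open>2i\<close> and \<open>2j + 1\<close> agree
  only if \<open>\<nu>^2 = q^(2(i + j))\<close>. For \<open>m = 1\<close> the even indices start at
  2, so \<open>i + j >= m\<close> in either case.\<close>

lemma path_inj:
  assumes "\<nu> \<noteq> 0" "\<And>i. i \<ge> m \<Longrightarrow> \<nu>\<^sup>2 \<noteq> q ^ (2 * i)" "m \<le> 1"
  shows "inj_on (path \<nu>) {m..}"
proof -
  have mixed: "path \<nu> a \<noteq> path \<nu> b" if "even a" "odd b" "a \<ge> m" "b \<ge> m" for a b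
  proof
    assume *: "path \<nu> a = path \<nu> b"
    obtain i j where ij: "a = 2 * i" "b = Suc (2 * j)"
      using \<open>even a\<close> \<open>odd b\<close> by (auto elim!: evenE oddE)
    with * assms(1) q_nonzero have "\<nu>\<^sup>2 = q ^ (2 * (i + j))"
      by (simp add: path_def field_simps power2_eq_square power_add distrib_left)
    moreover have "i + j \<ge> m"
      using that(3) assms(3) ij(1) by auto
    ultimately show False
      using assms(2) by blast
  qed
  show ?thesis
  proof (rule inj_onI)
    fix a b assume ab: "a \<in> {m..}" "b \<in> {m..}" "path \<nu> a = path \<nu> b"
    then have "even a \<longleftrightarrow> even b"
      using mixed[of a b] mixed[of b a] by auto
    then show "a = b"
      using ab(3) assms(1) q_nonzero q_power_inj[of a b] q_power_inj[of "a - 1" "b - 1"]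
      by (cases "even a") (auto simp: path_def field_simps elim!: oddE)
  qed
qed

text \<open>
  The condition on \<open>\<nu>\<^sup>2\<close> says that the path does not fold back onto itself. Every eigenvalue is
  \<open>good0\<close> or \<open>good1\<close> below, that is, non-folding in one of the two directions. If no end of the path
  existed, one could move backwards forever and obtain infinitely many eigenvalues.
\<close>

lemma chain_start:
  obtains \<nu> m w \<kappa> where "m \<le> (1::nat)" "\<nu> \<noteq> 0" "\<And>i. i \<ge> m \<Longrightarrow> \<nu>\<^sup>2 \<noteq> q ^ (2 * i)"
    "w \<noteq> 0" "X w = path \<nu> m *s w" "u (Suc m) w = \<kappa> *s w"
proof (rule ccontr)
  note start = that
  assume no_thesis: "\<not> thesis"
  have no_start: False
    if "m \<le> (1::nat)" "\<nu> \<noteq> 0" "\<And>i. i \<ge> m \<Longrightarrow> \<nu>\<^sup>2 \<noteq> q ^ (2 * i)"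
      "w \<noteq> 0" "X w = path \<nu> m *s w" "u (Suc m) w = \<kappa> *s w" for \<nu> m w \<kappa>
    using start[OF that] no_thesis by blast
  define ev where "ev \<mu> \<longleftrightarrow> (\<exists>w. w \<noteq> 0 \<and> X w = \<mu> *s w)" for \<mu>
  \<comment> \<open>\<open>good0 \<nu>\<close> permits a start at index 0 with parameter \<nu>, and
    \<open>good1 \<sigma>\<close> a start at index 1 with parameter
    \<open>inverse \<sigma>\<close>.\<close>
  define good0 where "good0 \<nu> \<longleftrightarrow> ev \<nu> \<and> (\<forall>i. \<nu>\<^sup>2 \<noteq> q ^ (2 * i))" for \<nu>
  define good1 where "good1 \<sigma> \<longleftrightarrow> ev \<sigma> \<and> (\<forall>i\<ge>1. \<sigma>\<^sup>2 * q ^ (2 * i) \<noteq> 1)" for \<sigma>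
  have ev_nz: "\<mu> \<noteq> 0" if "ev \<mu>" for \<mu>
    using that eigenvalue_nonzero unfolding ev_def by blast
  \<comment> \<open>If \<open>u n\<close> has no eigenvector in the \<mu>-eigenspace, then \<mu> is
    not a fold and the intertwined vector is nonzero.\<close>
  have move: "opposite n \<mu> \<noteq> \<mu> \<and> ev (opposite n \<mu>)"
    if "ev \<mu>" and *: "\<And>w \<kappa>. w \<noteq> 0 \<Longrightarrow> X w = \<mu> *s w \<Longrightarrow> u n w \<noteq> \<kappa> *s w" for n \<mu>
  proof -
    obtain w where w: "w \<noteq> 0" "X w = \<mu> *s w"
      using \<open>ev \<mu>\<close> unfolding ev_def by blast
    have ne: "opposite n \<mu> \<noteq> \<mu>"
      using fold_eigenvector[OF _ w(2,1)] * by blast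
    then obtain c where "X (u n w - c *s w) = opposite n \<mu> *s (u n w - c *s w)"
      using intertwiner w(2) by blast
    moreover have "u n w - c *s w \<noteq> 0"
      using *[OF w] by simp
    ultimately show ?thesis
      using ne unfolding ev_def by blast
  qed
  have step0: "good1 (inverse (q\<^sup>2 * \<nu>))" if "good0 \<nu>" for \<nu>
  proof -
    have \<nu>: "ev \<nu>" "\<And>i. \<nu>\<^sup>2 \<noteq> q ^ (2 * i)" "\<nu> \<noteq> 0"
      using that ev_nz unfolding good0_def by auto
    have "u 1 w \<noteq> \<kappa> *s w" if "w \<noteq> 0" "X w = \<nu> *s w" for w \<kappa>
      using no_start[of 0 \<nu> w \<kappa>] \<nu> that by (auto simp: path_def)
    from move[OF \<nu>(1) this]
    have *: "inverse (q\<^sup>2 * \<nu>) \<noteq> \<nu>" "ev (inverse (q\<^sup>2 * \<nu>))"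
      by (auto simp: opposite_def)
    have "(inverse (q\<^sup>2 * \<nu>))\<^sup>2 * q ^ (2 * i) \<noteq> 1" if "i \<ge> 1" for i
    proof
      assume eq: "(inverse (q\<^sup>2 * \<nu>))\<^sup>2 * q ^ (2 * i) = 1"
      then have eq': "q ^ (2 * i) = q ^ 4 * \<nu>\<^sup>2"
        using \<nu>(3) q_nonzero by (simp add: field_simps flip: power_mult)
      show False
      \<comment> \<open>For \<open>i = 1\<close> the equation says that \<open>t1\<close> folds at
        \<nu>, which \<open>move\<close> excludes; for larger \<open>i\<close> it contradicts
        \<open>good0 \<nu>\<close> at exponent \<open>i - 2\<close>.\<close>
      proof (cases "i = 1")
        case True
        then have "q\<^sup>2 * \<nu> * \<nu> = 1"
          using eq' q_nonzero by (simp add: power2_eq_square power4_eq_xxxx mult.assoc)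
        then show False
          using *(1) by (metis inverse_unique)
      next
        case False
        then obtain j where "i = j + 2"
          using \<open>i \<ge> 1\<close> by (metis One_nat_def Suc_1 add.commute le_add_diff_inverse le_antisym not_less_eq_eq)
        then have "2 * i = 4 + 2 * j"
          by simp
        then have "q ^ (2 * i) = q ^ 4 * q ^ (2 * j)"
          by (simp only: power_add)
        then have "\<nu>\<^sup>2 = q ^ (2 * j)"
          using eq' q_nonzero by auto
        then show False
          using \<nu>(2) by blast
      qed
    qed
    then show ?thesis
      using *(2) by (simp add: good1_def)
  qed
  have step1: "good0 (inverse \<sigma>)" if "good1 \<sigma>" for \<sigma>
  proof -
    have \<sigma>: "ev \<sigma>" "\<And>i. i \<ge> 1 \<Longrightarrow> \<sigma>\<^sup>2 * q ^ (2 * i) \<noteq> 1" "\<sigma> \<noteq> 0"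
      using that ev_nz unfolding good1_def by auto
    have "u (Suc 1) w \<noteq> \<kappa> *s w" if "w \<noteq> 0" "X w = \<sigma> *s w" for w \<kappa>
    proof
      assume "u (Suc 1) w = \<kappa> *s w"
      moreover have "(inverse \<sigma>)\<^sup>2 \<noteq> q ^ (2 * i)" if "i \<ge> 1" for i
        using \<sigma>(2)[OF that] \<sigma>(3) by (auto simp: field_simps)
      ultimately show False
        using no_start[of 1 "inverse \<sigma>" w \<kappa>] \<sigma>(3) that by (auto simp: path_def divide_inverse)
    qed
    from move[OF \<sigma>(1) this]
    have *: "inverse \<sigma> \<noteq> \<sigma>" "ev (inverse \<sigma>)"
      by (auto simp: opposite_def)
    have "(inverse \<sigma>)\<^sup>2 \<noteq> q ^ (2 * i)" for i
    proof (cases "i = 0")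
      case True
      have "\<sigma> * \<sigma> \<noteq> 1"
        using *(1) by (metis inverse_unique)
      then show ?thesis
        using True \<sigma>(3) by (simp add: field_simps power2_eq_square)
    next
      case False
      then show ?thesis
        using \<sigma>(2)[of i] \<sigma>(3) by (auto simp: field_simps)
    qed
    then show ?thesis
      using *(2) by (simp add: good0_def)
  qed
  \<comment> \<open>Going back by \<open>t1\<close> and then \<open>t0\<close> multiplies the
    eigenvalue by \<open>q^2\<close>, so no value recurs.\<close>
  have step: "good0 (q\<^sup>2 * \<nu>)" if "good0 \<nu>" for \<nu>
    using step1[OF step0[OF that]] by simp
  obtain S where S: "finite S" "span S = UNIV"
    using finite_span by blast
  obtain \<mu> where \<mu>: "ev \<mu>"
    using nontrivial exists_eigenvector[OF linear_X S] unfolding ev_def by metis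
  \<comment> \<open>An eigenvalue with \<open>\<mu>^2 = q^(2i)\<close> is \<open>good1\<close>,
    because no positive power of \<open>q\<close> is 1; any other is \<open>good0\<close>.\<close>
  have "\<exists>\<nu>. good0 \<nu>"
  proof (cases "\<exists>i. \<mu>\<^sup>2 = q ^ (2 * i)")
    case True
    then obtain i where i: "\<mu>\<^sup>2 = q ^ (2 * i)" ..
    have "\<mu>\<^sup>2 * q ^ (2 * j) \<noteq> 1" if "j \<ge> 1" for j
      using q_not_root[of "2 * i + 2 * j"] that by (simp add: i power_add)
    then show ?thesis
      using \<mu> step1 unfolding good1_def by blast
  qed (use \<mu> in \<open>auto simp: good0_def\<close>)
  then obtain \<nu> where \<nu>: "good0 \<nu>" ..
  have "good0 ((q\<^sup>2) ^ n * \<nu>)" for n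
    by (induction n) (use \<nu> step in \<open>auto simp: mult.assoc\<close>)
  then have "\<exists>w. w \<noteq> 0 \<and> X w = ((q\<^sup>2) ^ n * \<nu>) *s w" for n
    unfolding good0_def ev_def by blast
  then obtain w where w: "\<And>n. w n \<noteq> 0" "\<And>n. X (w n) = ((q\<^sup>2) ^ n * \<nu>) *s w n"
    by metis
  have "\<nu> \<noteq> 0"
    using \<nu> ev_nz unfolding good0_def by blast
  then have "inj (\<lambda>n. (q\<^sup>2) ^ n * \<nu>)"
    by (auto simp: inj_def q_power_inj simp flip: power_mult)
  from not_infinite_eigenvectors[OF linear_X S this, of w] w show False
    by blast
qed

end

section \<open>A chain of eigenvectors of \<open>X\<close>\<close>

text \<open>Padding \<open>w\<close> with zeros lets \<open>u_w\<close> and \<open>u_w_Suc\<close>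
  hold for every \<open>n >= m\<close>, also past the end of the chain; \<open>u_w_start\<close>
  closes it at its beginning.\<close>

locale XT_chain = XT_operators +
  fixes \<nu> :: 'a and m N :: nat and c :: "nat \<Rightarrow> 'a" and w :: "nat \<Rightarrow> 'b" and \<kappa> :: 'a
  assumes m_le: "m \<le> 1" and \<nu>_nonzero: "\<nu> \<noteq> 0" and m_less: "m < N"
    and \<nu>_generic: "\<And>i. i \<ge> m \<Longrightarrow> \<nu>\<^sup>2 \<noteq> q ^ (2 * i)"
    and X_w: "\<And>n. X (w n) = path \<nu> n *s w n"
    and w_nonzero: "\<And>n. w n \<noteq> 0 \<longleftrightarrow> m \<le> n \<and> n < N"
    and u_w: "\<And>n. m \<le> n \<Longrightarrow> u n (w n) = c n *s w n + w (Suc n)"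
    and u_w_Suc: "\<And>n. m \<le> n \<Longrightarrow>
      u n (w (Suc n)) = (U n - c n) *s w (Suc n) + (c n * (U n - c n) - 1) *s w n"
    and u_w_start: "u (Suc m) (w m) = \<kappa> *s w m"
begin

lemma w_zero: "n < m \<or> N \<le> n \<Longrightarrow> w n = 0"
  using w_nonzero[of n] by auto

lemma path_inj_on: "inj_on (path \<nu>) {m..}"
  using path_inj \<nu>_nonzero \<nu>_generic m_le by blast

lemma w_not_in_span:
  assumes "m \<le> n" "n < N"
  shows "w n \<notin> span (w ` {Suc n..})"
proof
  assume *: "w n \<in> span (w ` {Suc n..})"
  have "inj_on (path \<nu>) {n..<N}"
    using path_inj_on by (rule inj_on_subset) (use assms in auto)
  have ind: "inj_on w {n..<N}" "independent (w ` {n..<N})"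
    using eigenvectors_independent[OF linear_X _ \<open>inj_on (path \<nu>) {n..<N}\<close> X_w] w_nonzero assms(1)
    by auto
  have "w ` {Suc n..} \<subseteq> insert 0 (w ` {n..<N} - {w n})"
  proof
    fix x assume "x \<in> w ` {Suc n..}"
    then obtain i where i: "Suc n \<le> i" "x = w i" by auto
    show "x \<in> insert 0 (w ` {n..<N} - {w n})"
      using i ind(1) assms w_zero[of i] by (cases "i < N") (auto dest: inj_onD)
  qed
  then have "w n \<in> span (w ` {n..<N} - {w n})"
    using * span_mono by (metis span_insert_0 subsetD)
  moreover have "w n \<in> w ` {n..<N}"
    using assms by auto
  ultimately show False
    using ind(2) unfolding dependent_def by blast
qed

text \<open>The only way out of the tail is the step back from \<open>w k\<close>. It is absent at
  the start of the chain and when its coefficient vanishes; irreducibility does the rest.\<close>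

lemma span_tail:
  assumes "m \<le> k" "k < N" "k = m \<or> c (k - 1) * (U (k - 1) - c (k - 1)) = 1"
  shows "span (w ` {k..}) = UNIV"
proof -
  let ?W = "span (w ` {k..})"
  have w_mem: "w i \<in> ?W" if "k \<le> i" for i
    using that by (intro span_base) auto
  have inv: "f ` ?W \<subseteq> ?W"
    if f: "Vector_Spaces.linear scale scale f" and "\<And>i. k \<le> i \<Longrightarrow> f (w i) \<in> ?W" for f
  proof -
    interpret f: Vector_Spaces.linear scale scale f by (rule f)
    have "f x \<in> ?W" if "x \<in> ?W" for x
      using that
    proof (induction rule: span_induct_alt)
      case (step c x y)
      then show ?case
        using \<open>\<And>i. k \<le> i \<Longrightarrow> f (w i) \<in> ?W\<close>
        by (auto simp: f.add f.scale intro!: span_add span_scale)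
    qed (simp add: f.zero span_zero)
    then show ?thesis by blast
  qed
  have up: "u i (w i) \<in> ?W" if "k \<le> i" for i
    using that assms(1) by (auto simp: u_w intro!: span_add span_scale w_mem)
  have down: "u (Suc i) (w i) \<in> ?W" if "k \<le> i" for i
  proof (cases "i = m")
    case True
    then show ?thesis
      using that u_w_start by (auto intro: span_scale w_mem)
  next
    case False
    then have "m < i"
      using that assms(1) by simp
    \<comment> \<open>\<open>u (Suc i)\<close> equals \<open>u j\<close>, so on \<open>w i\<close>
      it is the step back along the link from \<open>j\<close> to \<open>i\<close>.\<close>
    then obtain j where j: "i = Suc j" "m \<le> j"
      by (cases i) auto
    show ?thesis
    proof (cases "k = i")
      case True
      then have "c j * (U j - c j) = 1"
        using assms(3) False j by auto
      then show ?thesis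
        using u_w_Suc[OF j(2)] that by (auto simp: j intro!: span_scale w_mem)
    next
      case False
      then show ?thesis
        using u_w_Suc[OF j(2)] that by (auto simp: j intro!: span_add span_scale w_mem)
    qed
  qed
  have "t0 (w i) \<in> ?W" "t1 (w i) \<in> ?W" if "k \<le> i" for i
    using up[OF that] down[OF that] by (cases "even i"; simp add: u_def)+
  moreover have "X (w i) \<in> ?W" "X' (w i) \<in> ?W" if "k \<le> i" for i
    using X_w[of i] X'_eigenvector[OF X_w[of i]] that by (auto intro: span_scale w_mem)
  ultimately have "?W = {0} \<or> ?W = UNIV"
    by (intro irreducible subspace_span inv linear_t0 linear_t1 linear_X linear_X')
  moreover have "w k \<in> ?W" "w k \<noteq> 0"
    using w_mem assms(1,2) w_nonzero by auto
  ultimately show ?thesis by blast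
qed

lemma span_w: "span (range w) = UNIV"
  using span_tail[of m] m_less span_mono[of "w ` {m..}" "range w"] by auto

text \<open>Otherwise the tail from \<open>Suc n\<close> would span the module, although
  \<open>w n\<close> lies outside it.\<close>

lemma back_coefficient:
  assumes "m \<le> n" "Suc n < N"
  shows "c n * (U n - c n) \<noteq> 1"
  using span_tail[of "Suc n"] w_not_in_span[of n] assms by auto

end

section \<open>Construction of the chain\<close>

lemma (in XT_operators) exists_chain:
  obtains \<nu> m N c w \<kappa> where "XT_chain scale q T0 T1 T2 T3 t0 t1 X X' \<nu> m N c w \<kappa>"
proof -
  obtain \<nu> m w0 \<kappa> where start: "m \<le> (1::nat)" "\<nu> \<noteq> 0" "\<And>i. i \<ge> m \<Longrightarrow> \<nu>\<^sup>2 \<noteq> q ^ (2 * i)"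
    "w0 \<noteq> 0" "X w0 = path \<nu> m *s w0" "u (Suc m) w0 = \<kappa> *s w0"
    using chain_start by metis
  have inj: "inj_on (path \<nu>) {m..}"
    using path_inj start by blast
  have "\<exists>c. \<forall>v. X v = path \<nu> n *s v \<longrightarrow>
      X (u n v - c *s v) = path \<nu> (Suc n) *s (u n v - c *s v)" if "m \<le> n" for n
  proof -
    have "opposite n (path \<nu> n) \<noteq> path \<nu> n"
      using inj_onD[OF inj, of "Suc n" n] that by (auto simp: path_Suc)
    then show ?thesis
      using intertwiner unfolding path_Suc by blast
  qed
  then obtain c where c: "\<And>n v. m \<le> n \<Longrightarrow> X v = path \<nu> n *s v \<Longrightarrow>
      X (u n v - c n *s v) = path \<nu> (Suc n) *s (u n v - c n *s v)"
    by metis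
  \<comment> \<open>The recursion is shifted by \<open>m\<close> so that the chain begins with
    \<open>w0\<close> at index \<open>m\<close>.\<close>
  define z where "z = rec_nat w0 (\<lambda>i v. u (m + i) v - c (m + i) *s v)"
  define w where "w n = (if n < m then 0 else z (n - m))" for n
  have w_m: "w m = w0"
    by (simp add: w_def z_def)
  have w_Suc: "w (Suc n) = u n (w n) - c n *s w n" if "m \<le> n" for n
    using that by (simp add: w_def z_def Suc_diff_le)
  have "X (w (m + i)) = path \<nu> (m + i) *s w (m + i)" for i
    by (induction i) (use start(5) in \<open>simp_all add: w_m w_Suc c\<close>)
  then have X_w: "X (w n) = path \<nu> n *s w n" for n
    by (cases "n < m") (auto simp: w_def X.zero not_less dest: le_Suc_ex)
  have zero_step: "w (Suc n) = 0" if "w n = 0" "m \<le> n" for n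
    using that by (simp add: w_Suc u.zero)
  obtain S where S: "finite S" "span S = UNIV"
    using finite_span by blast
  have "inj (\<lambda>i. path \<nu> (m + i))"
    by (rule injI) (drule inj_onD[OF inj], auto)
  from not_infinite_eigenvectors[OF linear_X S this, of "\<lambda>i. w (m + i)"]
  obtain i where i: "w (m + i) = 0"
    using X_w by blast
  define N where "N = (LEAST n. m \<le> n \<and> w n = 0)"
  have N: "m \<le> N" "w N = 0"
    using LeastI[of "\<lambda>n. m \<le> n \<and> w n = 0" "m + i"] i unfolding N_def by auto
  have "w n \<noteq> 0" if "m \<le> n" "n < N" for n
    using not_less_Least[of n "\<lambda>n. m \<le> n \<and> w n = 0"] that unfolding N_def by auto
  moreover have "w (N + n) = 0" for n
    by (induction n) (use N zero_step in auto)
  then have "w n = 0" if "N \<le> n" for n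
    using that by (metis le_Suc_ex)
  ultimately have w_nz: "w n \<noteq> 0 \<longleftrightarrow> m \<le> n \<and> n < N" for n
    by (metis leI w_def)
  have "m < N"
    using N start(4) w_m by (metis le_neq_implies_less)
  then have "XT_chain scale q T0 T1 T2 T3 t0 t1 X X' \<nu> m N c w \<kappa>"
    using start w_m X_w w_nz u_intertwiner[OF w_Suc]
    by unfold_locales auto
  then show thesis
    by (rule that)
qed

section \<open>The eigenspaces of \<open>t\<^sub>0\<close>\<close>

context vector_space
begin

lemma represents_tridiagonal:
  assumes "\<And>r. r \<le> d \<Longrightarrow> f (v r) = (if r = 0 then 0 else lo r *s v (r - 1)) + di r *s v r +
      (if r = d then 0 else up r *s v (Suc r))"
    and "\<And>r. 0 < r \<Longrightarrow> r \<le> d \<Longrightarrow> lo r \<noteq> 0" "\<And>r. r < d \<Longrightarrow> up r \<noteq> 0"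
  shows "\<exists>M. represents d v f M \<and> irred_tridiagonal d M"
proof -
  \<comment> \<open>Truncated subtraction makes \<open>i = r - 1\<close> true for
    \<open>i = r = 0\<close> as well, hence the inner test on \<open>r\<close>.\<close>
  define M where "M i r = (if i = r - 1 then if r = 0 then 0 else lo r else 0) +
    ((if i = r then di r else 0) + (if i = Suc r then up r else 0))" for i r
  have if_scale: "(if b then x else 0) *s y = (if b then x *s y else 0)" for b x y
    by simp
  have "represents d v f M"
    unfolding represents_def
  proof (intro allI impI)
    fix r assume "r \<le> d"
    then show "f (v r) = (\<Sum>i\<le>d. M i r *s v i)"
      by (auto simp: assms(1) M_def scale_left_distrib sum.distrib if_scale sum.delta add.assoc)
  qed
  moreover have "irred_tridiagonal d M"
    using assms(2,3) by (auto simp: irred_tridiagonal_def M_def)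
  ultimately show ?thesis by blast
qed

lemma represents_diagonal:
  assumes "\<And>r. r \<le> d \<Longrightarrow> f (v r) = \<theta> r *s v r"
  shows "\<exists>M. represents d v f M \<and> diagonal_matrix d M"
proof (intro exI conjI)
  have if_scale: "(if b then x else 0) *s y = (if b then x *s y else 0)" for b x y
    by simp
  show "represents d v f (\<lambda>i j. if i = j then \<theta> j else 0)"
    unfolding represents_def using assms by (simp add: if_scale sum.delta)
  show "diagonal_matrix d (\<lambda>i j. if i = j then \<theta> j else 0)"
    by (simp add: diagonal_matrix_def)
qed

end

locale XT_eigenspace = XT_chain +
  fixes k :: 'a
  assumes k_nonzero: "k \<noteq> 0" and T0_eq: "T0 = k + inverse k" and k_inverse: "k \<noteq> inverse k"
    and k_eigenvalue: "\<exists>v. v \<noteq> 0 \<and> t0 v = k *s v"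
begin

definition P :: "'b \<Rightarrow> 'b" where
  "P v = t0 v - inverse k *s v"

text \<open>\<open>T0 - t0\<close> and \<open>T1 - t1\<close> are the inverses of \<open>t0\<close>
  and \<open>t1\<close>, so this is \<open>Y + Y^-1\<close> for \<open>Y = t0 t1\<close>.\<close>

definition A :: "'b \<Rightarrow> 'b" where
  "A v = t0 (t1 v) + (T1 *s (T0 *s v - t0 v) - t1 (T0 *s v - t0 v))"

definition B :: "'b \<Rightarrow> 'b" where
  "B v = X v + X' v"

text \<open>
  \<open>P\<close> is a multiple of the projection onto the \<open>k\<close>-eigenspace of \<open>t\<^sub>0\<close>. The vector \<open>block j\<close> spans the
  image of the \<open>j\<close>-th block under \<open>P\<close>; it can vanish only if that block has a single nonzero vector,
  hence only at the two ends of the chain and beyond.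
\<close>

definition block :: "nat \<Rightarrow> 'b" where
  "block j = (if w (2 * j) = 0 then P (w (Suc (2 * j))) else P (w (2 * j)))"

lemma linear_P: "Vector_Spaces.linear scale scale P"
  unfolding Vector_Spaces.linear_iff
  by (simp add: P_def t0.add t0.scale scale_distribs mult.commute vector_space_axioms)

sublocale P: Vector_Spaces.linear scale scale P by (rule linear_P)

lemma linear_B: "Vector_Spaces.linear scale scale B"
  unfolding Vector_Spaces.linear_iff
  by (simp add: B_def X.add X'.add X.scale X'.scale scale_distribs vector_space_axioms)

sublocale B: Vector_Spaces.linear scale scale B by (rule linear_B)

lemma P_eigen: "t0 v = k *s v \<Longrightarrow> P v = (k - inverse k) *s v"
  by (simp add: P_def scale_distribs)

lemma t0_P: "t0 (P v) = k *s P v"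
  using k_nonzero by (simp add: P_def t0.diff t0.scale t0_t0 T0_eq scale_distribs)

lemma t0_w_even:
  assumes "w (2 * j) \<noteq> 0"
  shows "t0 (w (2 * j)) = c (2 * j) *s w (2 * j) + w (Suc (2 * j))"
    and "t0 (w (Suc (2 * j))) = (T0 - c (2 * j)) *s w (Suc (2 * j)) +
      (c (2 * j) * (T0 - c (2 * j)) - 1) *s w (2 * j)"
  using u_w[of "2 * j"] u_w_Suc[of "2 * j"] assms w_nonzero[of "2 * j"] by (auto simp: u_def U_def)

lemma t1_w_odd:
  "t1 (w (Suc (2 * j))) = c (Suc (2 * j)) *s w (Suc (2 * j)) + w (2 * Suc j)"
  "t1 (w (2 * Suc j)) = (T1 - c (Suc (2 * j))) *s w (2 * Suc j) +
    (c (Suc (2 * j)) * (T1 - c (Suc (2 * j))) - 1) *s w (Suc (2 * j))"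
  using u_w[of "Suc (2 * j)"] u_w_Suc[of "Suc (2 * j)"] m_le by (auto simp: u_def U_def)

lemma t1_w_zero: "\<exists>x. t1 (w 0) = x *s w 0"
proof (cases "m = 0")
  case True
  then show ?thesis
    using u_w_start by (auto simp: u_def)
next
  case False
  then show ?thesis
    using w_zero[of 0] by (auto simp: t1.zero)
qed

text \<open>The back coefficient \<open>c * (T0 - c) - 1\<close> factors as
  \<open>(k - c) * (c - inverse k)\<close> and is nonzero inside a block.\<close>

lemma factor_nonzero:
  assumes "w (2 * j) \<noteq> 0" "w (Suc (2 * j)) \<noteq> 0"
  shows "c (2 * j) \<noteq> k" "c (2 * j) \<noteq> inverse k"
proof -
  have "c (2 * j) * (T0 - c (2 * j)) \<noteq> 1"
    using back_coefficient[of "2 * j"] assms w_nonzero[of "2 * j"] w_nonzero[of "Suc (2 * j)"]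
    by (auto simp: U_def)
  then show "c (2 * j) \<noteq> k" "c (2 * j) \<noteq> inverse k"
    using k_nonzero by (auto simp: T0_eq)
qed

text \<open>\<open>w (2j + 1)\<close> is \<open>(t0 - c (2j)) w (2j)\<close>, and \<open>P\<close>
  commutes with \<open>t0\<close>, which acts as \<open>k\<close> on the image of
  \<open>P\<close>.\<close>

lemma P_w_odd:
  assumes "w (2 * j) \<noteq> 0"
  shows "P (w (Suc (2 * j))) = (k - c (2 * j)) *s P (w (2 * j))"
proof -
  have *: "c (2 * j) * (T0 - c (2 * j)) - 1 = (k - c (2 * j)) * (c (2 * j) - inverse k)"
    using k_nonzero by (simp add: T0_eq algebra_simps)
  show ?thesis
    unfolding P_def t0_w_even[OF assms] * by (simp add: T0_eq scale_distribs algebra_simps)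
qed

lemma P_w_odd_block: "\<exists>x. P (w (Suc (2 * j))) = x *s block j \<and> (w (Suc (2 * j)) \<noteq> 0 \<longrightarrow> x \<noteq> 0)"
proof (cases "w (2 * j) = 0")
  case True
  then show ?thesis
    by (intro exI[of _ 1]) (simp add: block_def)
next
  case False
  then show ?thesis
    using factor_nonzero[OF False] P_w_odd[OF False]
    by (intro exI[of _ "k - c (2 * j)"]) (auto simp: block_def)
qed

lemma w_nonzero_Suc: "w (2 * Suc j) \<noteq> 0 \<Longrightarrow> w (Suc (2 * j)) \<noteq> 0"
  using w_nonzero[of "2 * Suc j"] w_nonzero[of "Suc (2 * j)"] m_le by auto

text \<open>Since \<open>m <= 1\<close>, only block 0 can have a zero even vector followed by a
  nonzero odd one; in later blocks a zero even vector means that the chain has ended.\<close>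

lemma block_Suc: "block (Suc j) = P (w (2 * Suc j))"
proof (cases "w (2 * Suc j) = 0")
  case True
  then have "w (Suc (2 * Suc j)) = 0"
    using w_nonzero[of "2 * Suc j"] w_nonzero[of "Suc (2 * Suc j)"] m_le by auto
  then show ?thesis
    using True by (simp add: block_def P.zero)
qed (simp add: block_def)

lemma P_w_even_block: "\<exists>x. P (w (2 * j)) = x *s block j"
proof (cases "w (2 * j) = 0")
  case True
  then show ?thesis
    by (intro exI[of _ 0]) (simp add: P.zero)
next
  case False
  then show ?thesis
    by (intro exI[of _ 1]) (simp add: block_def)
qed

lemma block_eq:
  "\<exists>x y. block j = x *s w (2 * j) + y *s w (Suc (2 * j)) \<and>
    (block j \<noteq> 0 \<longrightarrow> (w (2 * j) \<noteq> 0 \<longrightarrow> x \<noteq> 0) \<and> (w (Suc (2 * j)) \<noteq> 0 \<longrightarrow> y \<noteq> 0))"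
proof (cases "w (2 * j) = 0")
  case False
  have eq: "block j = (c (2 * j) - inverse k) *s w (2 * j) + 1 *s w (Suc (2 * j))"
    using False by (simp add: block_def P_def t0_w_even[OF False] scale_distribs)
  have "c (2 * j) - inverse k \<noteq> 0" if "block j \<noteq> 0"
  proof (cases "w (Suc (2 * j)) = 0")
    case True
    then show ?thesis using that eq by auto
  next
    case False
    then show ?thesis using factor_nonzero(2)[OF \<open>w (2 * j) \<noteq> 0\<close>] by simp
  qed
  then show ?thesis
    using eq by (metis one_neq_zero)
next
  case True
  show ?thesis
  proof (cases "w (Suc (2 * j)) = 0")
    case True
    then show ?thesis
      using \<open>w (2 * j) = 0\<close> by (simp add: block_def P.zero)
  next
    case False
    \<comment> \<open>A lone odd vector is the start of a chain with \<open>m = 1\<close>. There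
      \<open>u (Suc m)\<close> is \<open>t0\<close>, so \<open>w 1\<close> is an eigenvector of
      \<open>t0\<close>.\<close>
    then have "j = 0" "m = 1"
      using True w_nonzero[of "2 * j"] w_nonzero[of "Suc (2 * j)"] m_le by auto
    then have "P (w (Suc (2 * j))) = (\<kappa> - inverse k) *s w (Suc (2 * j))"
      using u_w_start by (simp add: P_def u_def scale_distribs)
    then have "block j = 0 *s w (2 * j) + (\<kappa> - inverse k) *s w (Suc (2 * j))"
      using True by (simp add: block_def)
    then show ?thesis
      using True by (intro exI[of _ 0] exI[of _ "\<kappa> - inverse k"]) auto
  qed
qed

lemma t0_block: "t0 (block j) = k *s block j"
  by (simp add: block_def t0_P)

text \<open>The eigenvalues of \<open>X\<close> at indices \<open>2j\<close> and
  \<open>2j + 1\<close> are mutually inverse, so \<open>B\<close> has this one eigenvalue on the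
  whole block.\<close>

definition \<beta> :: "nat \<Rightarrow> 'a" where
  "\<beta> j = \<nu> / q ^ (2 * j) + q ^ (2 * j) / \<nu>"

lemma B_block: "B (block j) = \<beta> j *s block j"
proof -
  obtain x y where xy: "block j = x *s w (2 * j) + y *s w (Suc (2 * j))"
    using block_eq by blast
  have "B (w (2 * j)) = \<beta> j *s w (2 * j)" "B (w (Suc (2 * j))) = \<beta> j *s w (Suc (2 * j))"
    using X_w[of "2 * j"] X'_eigenvector[OF X_w, of "2 * j"]
      X_w[of "Suc (2 * j)"] X'_eigenvector[OF X_w, of "Suc (2 * j)"]
    by (simp_all add: B_def \<beta>_def path_def scale_distribs add.commute)
  then show ?thesis
    unfolding xy by (simp add: B.add B.scale scale_distribs mult.commute)
qed

text \<open>Here \<open>t0^-1\<close> acts as \<open>inverse k\<close>, so \<open>Y^-1\<close>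
  contributes \<open>inverse k * (T1 - t1)\<close>, whose \<open>t1\<close> part turns
  \<open>t0 t1\<close> into \<open>P t1\<close>.\<close>

lemma A_eigen:
  assumes "t0 v = k *s v"
  shows "A v = P (t1 v) + (inverse k * T1) *s v"
proof -
  have "T0 *s v - t0 v = inverse k *s v"
    by (simp add: assms T0_eq scale_distribs)
  then show ?thesis
    by (simp add: A_def P_def t1.scale mult.commute algebra_simps)
qed

text \<open>\<open>t1\<close> links the odd vector of each block with the even vector of the next
  one, and \<open>P\<close> sends every chain vector to a multiple of its block.\<close>

lemma A_block:
  "\<exists>lo di up. A (block j) = (if j = 0 then 0 else lo *s block (j - 1)) + di *s block j + up *s block (Suc j) \<and>
    (j \<noteq> 0 \<and> block j \<noteq> 0 \<longrightarrow> lo \<noteq> 0) \<and> (block j \<noteq> 0 \<and> block (Suc j) \<noteq> 0 \<longrightarrow> up \<noteq> 0)"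
proof -
  obtain x y where xy: "block j = x *s w (2 * j) + y *s w (Suc (2 * j))"
    "block j \<noteq> 0 \<Longrightarrow> w (2 * j) \<noteq> 0 \<Longrightarrow> x \<noteq> 0" "block j \<noteq> 0 \<Longrightarrow> w (Suc (2 * j)) \<noteq> 0 \<Longrightarrow> y \<noteq> 0"
    using block_eq[of j] by blast
  have Pt1: "P (t1 (block j)) = x *s P (t1 (w (2 * j))) + y *s P (t1 (w (Suc (2 * j))))"
    by (simp add: xy(1) t1.add t1.scale P.add P.scale)
  obtain z where z: "P (t1 (w (Suc (2 * j)))) = z *s block j + block (Suc j)"
  proof -
    obtain z where "P (w (Suc (2 * j))) = z *s block j"
      using P_w_odd_block by blast
    then have "P (t1 (w (Suc (2 * j)))) = (c (Suc (2 * j)) * z) *s block j + block (Suc j)"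
      by (simp add: t1_w_odd(1) P.add P.scale block_Suc del: mult_Suc_right)
    then show thesis
      by (rule that)
  qed
  have up: "y \<noteq> 0" if "block j \<noteq> 0" "block (Suc j) \<noteq> 0"
  proof -
    have "w (2 * Suc j) \<noteq> 0"
      using that(2) P.zero unfolding block_Suc by metis
    then show ?thesis
      using xy(3)[OF that(1)] w_nonzero_Suc by blast
  qed
  show ?thesis
  proof (cases j)
    case 0
    obtain a where "t1 (w 0) = a *s w 0"
      using t1_w_zero by blast
    moreover obtain b where "P (w 0) = b *s block 0"
      using P_w_even_block[of 0] by auto
    ultimately have "P (t1 (w (2 * j))) = (a * b) *s block j"
      by (simp add: 0 P.scale)
    then have "A (block j) = (x * (a * b) + y * z + inverse k * T1) *s block j + y *s block (Suc j)"
      unfolding A_eigen[OF t0_block] Pt1 z by (simp add: scale_distribs algebra_simps)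
    then show ?thesis
      using up 0 by (intro exI[of _ 0] exI[of _ "x * (a * b) + y * z + inverse k * T1"] exI[of _ y]) auto
  next
    case (Suc i)
    let ?c = "c (Suc (2 * i))"
    obtain b where b: "P (w (Suc (2 * i))) = b *s block i" "w (Suc (2 * i)) \<noteq> 0 \<Longrightarrow> b \<noteq> 0"
      using P_w_odd_block by blast
    \<comment> \<open>The factors follow the way down: the coordinate of \<open>block j\<close>
      along \<open>w (2j)\<close>, the back coefficient of \<open>t1\<close>, and the factor by
      which \<open>P\<close> maps \<open>w (2j - 1)\<close> to \<open>block i\<close>.\<close>
    let ?lo = "x * (?c * (T1 - ?c) - 1) * b"
    let ?di = "x * (T1 - ?c) + y * z + inverse k * T1"
    have eq: "P (t1 (w (2 * j))) = (T1 - ?c) *s block j + ((?c * (T1 - ?c) - 1) * b) *s block i"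
      by (simp add: Suc t1_w_odd(2) P.add P.scale b(1) block_Suc del: mult_Suc_right)
    have "A (block j) = ?lo *s block i + ?di *s block j + y *s block (Suc j)"
      unfolding A_eigen[OF t0_block] Pt1 z eq by (simp add: scale_distribs algebra_simps)
    moreover have "?lo \<noteq> 0" if "block j \<noteq> 0"
    proof -
      have nz: "w (2 * j) \<noteq> 0"
        using that by (auto simp: Suc block_Suc P.zero simp del: mult_Suc_right)
      then have "?c * (T1 - ?c) \<noteq> 1"
        using back_coefficient[of "Suc (2 * i)"] w_nonzero[of "2 * j"] m_le by (auto simp: Suc U_def)
      then show ?thesis
        using xy(2)[OF that nz] b(2) w_nonzero_Suc[of i] nz by (auto simp: Suc)
    qed
    ultimately show ?thesis
      using up Suc by (intro exI[of _ ?lo] exI[of _ ?di] exI[of _ y]) auto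
  qed
qed

text \<open>Up to a nonzero factor \<open>\<beta> i - \<beta> j\<close> is
  \<open>(q^(2j) - q^(2i)) * (\<nu>^2 - q^(2i + 2j))\<close>. The second factor is nonzero by
  genericity of \<nu>, as \<open>i \<noteq> j\<close> gives \<open>i + j >= 1 >= m\<close>.\<close>

lemma \<beta>_inj: "inj_on \<beta> {j. block j \<noteq> 0}"
proof (rule inj_onI)
  fix i j assume "i \<in> {j. block j \<noteq> 0}" "j \<in> {j. block j \<noteq> 0}" and eq: "\<beta> i = \<beta> j"
  show "i = j"
  proof (rule ccontr)
    assume "i \<noteq> j"
    then have "i + j \<ge> m"
      using m_le by auto
    then have "\<nu> * \<nu> \<noteq> q ^ (2 * i) * q ^ (2 * j)"
      using \<nu>_generic[of "i + j"] by (simp add: power_add power2_eq_square distrib_left)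
    moreover have "q ^ (2 * i) \<noteq> q ^ (2 * j)"
      using \<open>i \<noteq> j\<close> by (simp add: q_power_inj)
    moreover have "(q ^ (2 * j) - q ^ (2 * i)) * (\<nu> * \<nu> - q ^ (2 * i) * q ^ (2 * j)) = 0"
    proof -
      let ?a = "q ^ (2 * i)" and ?b = "q ^ (2 * j)"
      have "(?b - ?a) * (\<nu> * \<nu> - ?a * ?b) = \<nu> * ?a * ?b * (\<beta> i - \<beta> j)"
        using \<nu>_nonzero q_nonzero by (simp add: \<beta>_def field_simps)
      then show ?thesis
        using eq by simp
    qed
    ultimately show False
      by simp
  qed
qed

text \<open>So the nonzero blocks fill an interval. An interior block has two nonzero chain vectors,
  and its vanishing would be a linear dependence between them.\<close>

lemma block_nonzero_between:
  assumes "block i \<noteq> 0" "block l \<noteq> 0" "i < j" "j < l"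
  shows "block j \<noteq> 0"
proof
  assume "block j = 0"
  have "w (2 * l) \<noteq> 0"
    using assms(2-4) by (cases l) (auto simp: block_Suc P.zero simp del: mult_Suc_right)
  then have nz: "w (2 * j) \<noteq> 0" "w (Suc (2 * j)) \<noteq> 0"
    using assms(3,4) m_le w_nonzero[of "2 * l"] w_nonzero[of "2 * j"] w_nonzero[of "Suc (2 * j)"] by auto
  have "w (2 * j) \<in> span (w ` {Suc (2 * j)..})"
  proof -
    have "(c (2 * j) - inverse k) *s w (2 * j) = - w (Suc (2 * j))"
      using \<open>block j = 0\<close> nz(1) unfolding block_def P_def t0_w_even(1)[OF nz(1)]
      by (simp add: scale_distribs eq_neg_iff_add_eq_0 algebra_simps)
    moreover have "- w (Suc (2 * j)) \<in> span (w ` {Suc (2 * j)..})"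
      by (intro span_neg span_base) auto
    ultimately have "inverse (c (2 * j) - inverse k) *s (c (2 * j) - inverse k) *s w (2 * j)
        \<in> span (w ` {Suc (2 * j)..})"
      by (simp only: span_scale)
    then show ?thesis
      using factor_nonzero(2)[OF nz] by simp
  qed
  then show False
    using w_not_in_span[of "2 * j"] nz(1) w_nonzero by blast
qed

lemma eigenspace_eq: "eigenspace t0 k = span (range block)"
proof (intro equalityI subsetI)
  fix v assume "v \<in> eigenspace t0 k"
  then have v: "t0 v = k *s v"
    by (simp add: eigenspace_def)
  have P_w: "P (w n) \<in> span (range block)" for n
  proof -
    obtain j where "n = 2 * j \<or> n = Suc (2 * j)"
      by (metis evenE oddE Suc_eq_plus1)
    moreover obtain x y where "P (w (2 * j)) = x *s block j" "P (w (Suc (2 * j))) = y *s block j"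
      using P_w_even_block P_w_odd_block by metis
    moreover have "block j \<in> span (range block)"
      by (simp add: span_base)
    ultimately show ?thesis
      by (auto simp: span_scale)
  qed
  have "P x \<in> span (range block)" if "x \<in> span (range w)" for x
    using that
  proof (induction rule: span_induct_alt)
    case (step c x y)
    then show ?case
      using P_w by (auto simp: P.add P.scale intro!: span_add span_scale)
  qed (simp add: P.zero span_zero)
  then have "inverse (k - inverse k) *s P v \<in> span (range block)"
    by (intro span_scale) (simp add: span_w)
  then show "v \<in> span (range block)"
    using k_inverse by (simp add: P_eigen[OF v])
next
  fix v assume "v \<in> span (range block)"
  then show "v \<in> eigenspace t0 k"
    unfolding eigenspace_def mem_Collect_eq
    by (induction rule: span_induct_alt)
      (auto simp: t0.zero t0.add t0.scale t0_block scale_distribs mult.commute)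
qed

lemma A_eigenspace: "t0 v = k *s v \<Longrightarrow> t0 (A v) = k *s A v"
  by (simp add: A_eigen t0.add t0.scale t0_P scale_distribs mult.commute)

lemma exists_standard_ordering:
  "\<exists>S. finite S \<and> span S = eigenspace t0 k" (is ?finite)
  "0 < dim (eigenspace t0 k)" (is ?dim)
  "\<exists>\<theta>. standard_ordering (eigenspace t0 k) A B \<theta> \<and> q_Racah_seq q (diameter (eigenspace t0 k)) \<theta>"
    (is ?ordering)
proof -
  let ?K = "{j. block j \<noteq> 0}" and ?E = "eigenspace t0 k"
  have "?K \<noteq> {}"
  proof
    assume "?K = {}"
    then have "range block = {0}" by auto
    then have "?E = {0}"
      by (simp add: eigenspace_eq)
    then show False
      using k_eigenvalue by (auto simp: eigenspace_def)
  qed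
  have fin: "finite ?K"
  proof (rule finite_subset)
    show "?K \<subseteq> {..N}"
    proof
      fix j assume "j \<in> ?K"
      then have "w (2 * j) \<noteq> 0 \<or> w (Suc (2 * j)) \<noteq> 0"
        by (auto simp: block_def P.zero)
      then show "j \<in> {..N}"
        using w_nonzero[of "2 * j"] w_nonzero[of "Suc (2 * j)"] by auto
    qed
  qed simp
  \<comment> \<open>Blocks at the ends may vanish, so the basis runs from the first nonzero block
    \<open>a\<close> to the last one, \<open>a + d\<close>.\<close>
  define a where "a = Min ?K"
  define d where "d = Max ?K - a"
  have a: "a \<in> ?K" and ad: "a + d \<in> ?K" and bounds: "\<And>j. j \<in> ?K \<Longrightarrow> a \<le> j \<and> j \<le> a + d"
    using Min_in[OF fin \<open>?K \<noteq> {}\<close>] Max_in[OF fin \<open>?K \<noteq> {}\<close>] Min_le[OF fin] Max_ge[OF fin]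
    by (auto simp: a_def d_def)
  have K_iff: "block j \<noteq> 0 \<longleftrightarrow> a \<le> j \<and> j \<le> a + d" for j
  proof
    assume "a \<le> j \<and> j \<le> a + d"
    then consider "j = a" | "j = a + d" | "a < j" "j < a + d"
      by linarith
    then show "block j \<noteq> 0"
      using a ad block_nonzero_between[of a "a + d" j] by cases auto
  qed (use bounds in auto)
  define v where "v r = block (a + r)" for r
  define \<theta> where "\<theta> r = \<beta> (a + r)" for r
  have v_nz: "v r \<noteq> 0" if "r \<in> {..d}" for r
    using that K_iff by (simp add: v_def)
  have Bv: "B (v r) = \<theta> r *s v r" for r
    by (simp add: v_def \<theta>_def B_block)
  have \<theta>_inj: "inj_on \<theta> {..d}"
  proof (rule inj_onI)
    fix x y assume "x \<in> {..d}" "y \<in> {..d}" "\<theta> x = \<theta> y"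
    then show "x = y"
      using inj_onD[OF \<beta>_inj, of "a + x" "a + y"] by (simp add: \<theta>_def K_iff)
  qed
  note ind = eigenvectors_independent[OF linear_B finite_atMost \<theta>_inj Bv v_nz]
  have "range block \<subseteq> insert 0 (v ` {..d})"
  proof
    fix x assume "x \<in> range block"
    then obtain j where j: "x = block j" by auto
    show "x \<in> insert 0 (v ` {..d})"
    proof (cases "block j = 0")
      case False
      then have "x = v (j - a)" "j - a \<in> {..d}"
        using K_iff[of j] j by (auto simp: v_def)
      then show ?thesis by blast
    qed (use j in simp)
  qed
  then have "span (range block) \<subseteq> span (v ` {..d})"
    by (metis span_insert_0 span_mono)
  moreover have "span (v ` {..d}) \<subseteq> span (range block)"
    by (intro span_mono) (auto simp: v_def)
  ultimately have E: "?E = span (v ` {..d})"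
    by (simp add: eigenspace_eq)
  have dim: "dim ?E = Suc d"
    using dim_span_eq_card_independent[OF ind(2)] ind(1) by (simp add: E card_image)
  then have diam: "diameter ?E = d"
    by (simp add: diameter_def)
  obtain lo di up where coeffs:
    "\<And>j. A (block j) = (if j = 0 then 0 else lo j *s block (j - 1)) + di j *s block j + up j *s block (Suc j)"
    "\<And>j. j \<noteq> 0 \<Longrightarrow> block j \<noteq> 0 \<Longrightarrow> lo j \<noteq> 0"
    "\<And>j. block j \<noteq> 0 \<Longrightarrow> block (Suc j) \<noteq> 0 \<Longrightarrow> up j \<noteq> 0"
    using A_block by metis
  have "\<exists>M. represents d v A M \<and> irred_tridiagonal d M"
  proof (rule represents_tridiagonal)
    fix r assume "r \<le> d"
    have "r \<noteq> 0 \<Longrightarrow> a + r - 1 = a + (r - 1)" by simp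
    \<comment> \<open>The neighbours just outside the interval vanish, which truncates the
      three-term relation at both ends.\<close>
    moreover have "block (a - 1) = 0" if "a \<noteq> 0"
      using K_iff[of "a - 1"] that by auto
    moreover have "block (Suc (a + d)) = 0"
      using K_iff[of "Suc (a + d)"] by auto
    ultimately show "A (v r) = (if r = 0 then 0 else lo (a + r) *s v (r - 1)) + di (a + r) *s v r +
        (if r = d then 0 else up (a + r) *s v (Suc r))"
      unfolding v_def coeffs(1)[of "a + r"] by auto
  next
    show "lo (a + r) \<noteq> 0" if "0 < r" "r \<le> d" for r
      using coeffs(2) K_iff that by simp
    show "up (a + r) \<noteq> 0" if "r < d" for r
      using coeffs(3) K_iff that by simp
  qed
  moreover have "\<exists>D. represents d v B D \<and> diagonal_matrix d D"
    using represents_diagonal Bv by blast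
  ultimately have "tridiag_diag_basis ?E d A B v"
    using ind E by (simp add: tridiag_diag_basis_def ordered_basis_def)
  moreover have "bij_betw \<theta> {..d} (eigenvalues_on ?E B)"
    using eigenvalues_on_span_eigenvectors[OF linear_B finite_atMost \<theta>_inj Bv v_nz] \<theta>_inj
    by (simp add: bij_betw_def E)
  ultimately have "standard_ordering ?E A B \<theta>"
    using Bv by (auto simp: standard_ordering_def diam)
  moreover have "q_Racah_seq q d \<theta>"
    unfolding q_Racah_seq_def
  proof (intro exI conjI allI impI)
    \<comment> \<open>Found by matching \<open>\<alpha> q^(2r - d)\<close> with the summand
      \<open>q^(2(a + r)) / \<nu>\<close> of \<open>\<beta> (a + r)\<close>.\<close>
    let ?\<alpha> = "q ^ (2 * a + d) / \<nu>"
    show "?\<alpha> \<noteq> 0"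
      using q_nonzero \<nu>_nonzero by simp
    fix r assume "r \<le> d"
    have r: "2 * int r = int (2 * r)"
      by simp
    have "q powi (2 * int r - int d) = q ^ (2 * r) / q ^ d"
      by (simp only: r power_int_of_nat power_int_diff[OF disjI1[OF q_nonzero]])
    moreover have "q powi (int d - 2 * int r) = q ^ d / q ^ (2 * r)"
      by (simp only: r power_int_of_nat power_int_diff[OF disjI1[OF q_nonzero]])
    ultimately show "\<theta> r = ?\<alpha> * q powi (2 * int r - int d) + inverse ?\<alpha> * q powi (int d - 2 * int r)"
      using q_nonzero \<nu>_nonzero by (simp add: \<theta>_def \<beta>_def power_add field_simps)
  qed
  ultimately show ?ordering
    by (auto simp: diam)
  show ?dim
    by (simp add: dim)
  show ?finite
    using E by blast
qed

end

section \<open>The symmetry exchanging \<open>X\<close> and \<open>Y\<close>\<close>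

lemma (in XT_operators) eigenspace_Leonard:
  fixes k :: 'f
  defines "E \<equiv> eigenspace t0 k"
    and "A \<equiv> \<lambda>v. t0 (t1 v) + (T1 *s (T0 *s v - t0 v) - t1 (T0 *s v - t0 v))"
  assumes "k \<noteq> 0" "T0 = k + inverse k" "k \<noteq> inverse k" "\<exists>v. v \<noteq> 0 \<and> t0 v = k *s v"
  shows "\<exists>S. finite S \<and> span S = E" "0 < dim E" "A ` E \<subseteq> E"
    "\<exists>\<theta>. standard_ordering E A (\<lambda>v. X v + X' v) \<theta> \<and> q_Racah_seq q (diameter E) \<theta>"
proof -
  obtain \<nu> m N c w \<kappa> where "XT_chain scale q T0 T1 T2 T3 t0 t1 X X' \<nu> m N c w \<kappa>"
    using exists_chain by metis
  then interpret XT_chain scale q T0 T1 T2 T3 t0 t1 X X' \<nu> m N c w \<kappa> .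
  interpret e: XT_eigenspace scale q T0 T1 T2 T3 t0 t1 X X' \<nu> m N c w \<kappa> k
    by unfold_locales (use assms in auto)
  have AB: "A = e.A" "(\<lambda>v. X v + X' v) = e.B"
    by (auto simp: A_def e.A_def e.B_def)
  show "\<exists>S. finite S \<and> span S = E" "0 < dim E"
    "\<exists>\<theta>. standard_ordering E A (\<lambda>v. X v + X' v) \<theta> \<and> q_Racah_seq q (diameter E) \<theta>"
    unfolding E_def AB by (rule e.exists_standard_ordering)+
  show "A ` E \<subseteq> E"
    unfolding E_def AB using e.A_eigenspace by (auto simp: eigenspace_def)
qed

section \<open>Operators satisfying the DAHA relations\<close>

locale daha_operators = vector_space scale
  for scale :: "'f::alg_closed_field \<Rightarrow> 'v::ab_group_add \<Rightarrow> 'v" (infixr \<open>*s\<close> 75) +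
  fixes q T0 T1 T2 T3 :: 'f and t0 t1 t2 t3 s0 s1 s2 s3 :: "'v \<Rightarrow> 'v"
  assumes q_nonzero: "q \<noteq> 0"
    and q_not_root: "\<And>n::nat. n > 0 \<Longrightarrow> q ^ n \<noteq> 1"
    and linear_t: "Vector_Spaces.linear scale scale t0" "Vector_Spaces.linear scale scale t1"
      "Vector_Spaces.linear scale scale t2" "Vector_Spaces.linear scale scale t3"
    and t_s: "t0 (s0 v) = v" "t1 (s1 v) = v" "t2 (s2 v) = v" "t3 (s3 v) = v"
    and s_t: "s0 (t0 v) = v" "s1 (t1 v) = v" "s2 (t2 v) = v" "s3 (t3 v) = v"
    and t_plus_s: "t0 v + s0 v = T0 *s v" "t1 v + s1 v = T1 *s v"
      "t2 v + s2 v = T2 *s v" "t3 v + s3 v = T3 *s v"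
    and t_product: "t0 (t1 (t2 (t3 v))) = inverse q *s v"
    and finite_span: "\<exists>S. finite S \<and> span S = UNIV"
    and nontrivial: "\<exists>v::'v. v \<noteq> 0"
    and irreducible: "\<And>W. subspace W \<Longrightarrow> t0 ` W \<subseteq> W \<Longrightarrow> t1 ` W \<subseteq> W \<Longrightarrow> t2 ` W \<subseteq> W \<Longrightarrow> t3 ` W \<subseteq> W
      \<Longrightarrow> W = {0} \<or> W = UNIV"
    and diagonalizable_X: "diagonalizable (\<lambda>v. t3 (t0 v))"
    and diagonalizable_Y: "diagonalizable (\<lambda>v. t0 (t1 v))"
begin

sublocale t0: Vector_Spaces.linear scale scale t0 by (rule linear_t)
sublocale t1: Vector_Spaces.linear scale scale t1 by (rule linear_t)
sublocale t2: Vector_Spaces.linear scale scale t2 by (rule linear_t)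
sublocale t3: Vector_Spaces.linear scale scale t3 by (rule linear_t)

lemma s_eq: "s0 v = T0 *s v - t0 v" "s1 v = T1 *s v - t1 v" "s2 v = T2 *s v - t2 v" "s3 v = T3 *s v - t3 v"
  using t_plus_s[of v] by (auto simp: eq_diff_eq add.commute)

lemma linear_s: "Vector_Spaces.linear scale scale s0" "Vector_Spaces.linear scale scale s1"
  "Vector_Spaces.linear scale scale s2" "Vector_Spaces.linear scale scale s3"
  unfolding Vector_Spaces.linear_iff
  by (simp_all add: s_eq t0.add t1.add t2.add t3.add t0.scale t1.scale t2.scale t3.scale
      scale_right_distrib scale_right_diff_distrib mult.commute vector_space_axioms)

lemma linear_compose:
  assumes "Vector_Spaces.linear scale scale f" "Vector_Spaces.linear scale scale g"
  shows "Vector_Spaces.linear scale scale (\<lambda>v. f (g v))"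
  using Vector_Spaces.linear_compose[OF assms(2,1)] by (simp add: comp_def)

lemma diagonalizable_inverse:
  assumes "diagonalizable f" "Vector_Spaces.linear scale scale g" "\<And>v. g (f v) = v"
  shows "diagonalizable g"
proof -
  interpret g: Vector_Spaces.linear scale scale g by (rule assms(2))
  obtain S where S: "independent S" "span S = UNIV" "\<And>b. b \<in> S \<Longrightarrow> \<exists>c. f b = c *s b"
    using assms(1) unfolding diagonalizable_def by blast
  have "\<exists>c. g b = c *s b" if "b \<in> S" for b
  proof -
    obtain c where c: "f b = c *s b"
      using S(3) \<open>b \<in> S\<close> by blast
    then have b: "b = c *s g b"
      using assms(3)[of b] by (simp add: g.scale)
    moreover have "b \<noteq> 0"
      using S(1) \<open>b \<in> S\<close> dependent_zero by blast
    ultimately have "c \<noteq> 0" by auto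
    then have "g b = inverse c *s c *s g b"
      by simp
    then show ?thesis
      using b by metis
  qed
  then show ?thesis
    using S(1,2) unfolding diagonalizable_def by blast
qed

text \<open>A scalar product of invertible operators can be rotated by conjugating with its last or
  first factor.\<close>

lemma t_product_rotate: "t3 (t0 (t1 (t2 v))) = inverse q *s v" "t1 (t2 (t3 (t0 v))) = inverse q *s v"
proof -
  show "t3 (t0 (t1 (t2 v))) = inverse q *s v"
    using arg_cong[OF t_product[of "s3 v"], of t3] by (simp add: t_s t3.scale)
  show "t1 (t2 (t3 (t0 v))) = inverse q *s v"
    using arg_cong[OF t_product[of "t0 v"], of s0] linear_s(1)
    by (simp add: s_t Vector_Spaces.linear_iff)
qed

lemma XT_operators:
  "XT_operators scale q T0 T1 T2 T3 t0 t1 (\<lambda>v. t3 (t0 v)) (\<lambda>v. s0 (s3 v))"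
proof (intro XT_operators.intro XT_operators_axioms.intro vector_space_axioms)
  show "Vector_Spaces.linear scale scale (\<lambda>v. t3 (t0 v))" "Vector_Spaces.linear scale scale (\<lambda>v. s0 (s3 v))"
    by (rule linear_compose[OF linear_t(4) linear_t(1)] linear_compose[OF linear_s(1) linear_s(4)])+
  have t_t: "t0 (t0 v) = T0 *s t0 v - v" "t1 (t1 v) = T1 *s t1 v - v" for v
    using s_t[of v] s_eq(1)[of "t0 v"] s_eq(2)[of "t1 v"] by (auto simp: algebra_simps)
  then show "t0 (t0 v) = T0 *s t0 v - v" "t1 (t1 v) = T1 *s t1 v - v" for v
    by auto
  show "t3 (t0 (t0 v)) = t0 (s0 (s3 v)) + T0 *s t3 (t0 v) - T3 *s v" for v
    by (simp add: t_t t_s s_eq(4) t3.diff t3.scale algebra_simps)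
  show "t3 (t0 (t1 v)) = inverse (q\<^sup>2) *s t1 (s0 (s3 v)) + (T2 / q) *s v - (T1 / q\<^sup>2) *s s0 (s3 v)" for v
  proof -
    \<comment> \<open>The rotated product makes \<open>t3 t0 t1\<close> a multiple of
      \<open>s2 = T2 - t2\<close>, and \<open>t2\<close> a multiple of \<open>s1 X^-1\<close>;
      together they eliminate \<open>t2\<close>.\<close>
    have "t3 (t0 (t1 v)) = inverse q *s s2 v"
      using t_product_rotate(1)[of "s2 v"] by (simp add: t_s)
    moreover have "t2 v = inverse q *s s1 (s0 (s3 v))"
      using arg_cong[OF t_product_rotate(1)[of v], of "\<lambda>v. s1 (s0 (s3 v))"] linear_s
      by (simp add: s_t Vector_Spaces.linear_iff)
    ultimately show ?thesis
      by (simp add: s_eq(3) s_eq(2)[of "s0 (s3 v)"] scale_right_diff_distrib power2_eq_square divide_inverse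
          mult.commute mult.left_commute)
  qed
  show "W = {0} \<or> W = UNIV"
    if W: "subspace W" "t0 ` W \<subseteq> W" "t1 ` W \<subseteq> W" "(\<lambda>v. t3 (t0 v)) ` W \<subseteq> W" "(\<lambda>v. s0 (s3 v)) ` W \<subseteq> W" for W
  \<comment> \<open>Invariance under \<open>t3\<close> and \<open>t2\<close> is recovered from
    \<open>t3 = X s0\<close> and \<open>t2 = q^-1 s1 X^-1\<close>.\<close>
  proof (rule irreducible)
    have s: "s0 v \<in> W" "s1 v \<in> W" if "v \<in> W" for v
      using that W(1-3) by (auto simp: s_eq intro!: subspace_diff subspace_scale)
    show "t3 ` W \<subseteq> W"
    proof
      fix x assume "x \<in> t3 ` W"
      then obtain v where "v \<in> W" "x = t3 (t0 (s0 v))"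
        by (auto simp: t_s)
      then show "x \<in> W"
        using s W(4) by blast
    qed
    show "t2 ` W \<subseteq> W"
    proof
      fix x assume "x \<in> t2 ` W"
      then obtain v where "v \<in> W" "x = t2 v"
        by auto
      moreover have "t2 v = inverse q *s s1 (s0 (s3 v))"
        using arg_cong[OF t_product_rotate(1)[of v], of "\<lambda>v. s1 (s0 (s3 v))"] linear_s
        by (simp add: s_t Vector_Spaces.linear_iff)
      ultimately show "x \<in> W"
        using s W(1,5) by (auto intro!: subspace_scale)
    qed
  qed (use W in auto)
qed (use q_nonzero q_not_root finite_span nontrivial diagonalizable_X t_s s_t linear_t in auto)

text \<open>The new \<open>X\<close> is \<open>s1 s0 = Y^-1\<close> and the new \<open>Y\<close> is
  \<open>s0 s3 = X^-1\<close>. The new product relation is the inverse of the second rotated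
  one.\<close>

lemma dual: "daha_operators scale (inverse q) T0 T3 T2 T1 s0 s3 s2 s1 t0 t3 t2 t1"
proof (intro daha_operators.intro daha_operators_axioms.intro vector_space_axioms)
  show "inverse q ^ n \<noteq> 1" if "n > 0" for n :: nat
    using q_not_root[OF that] q_nonzero by (simp add: power_inverse)
  show "s0 v + t0 v = T0 *s v" "s3 v + t3 v = T3 *s v" "s2 v + t2 v = T2 *s v" "s1 v + t1 v = T1 *s v" for v
    by (simp_all add: s_eq)
  show "s0 (s3 (s2 (s1 v))) = inverse (inverse q) *s v" for v
  proof -
    have "v = inverse q *s s0 (s3 (s2 (s1 v)))"
      using arg_cong[OF t_product_rotate(2)[of "s0 (s3 (s2 (s1 v)))"], of "\<lambda>v. v"] by (simp add: t_s)
    then have "q *s v = q *s inverse q *s s0 (s3 (s2 (s1 v)))"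
      by metis
    then show ?thesis
      using q_nonzero by simp
  qed
  show "W = {0} \<or> W = UNIV"
    if W: "subspace W" "s0 ` W \<subseteq> W" "s3 ` W \<subseteq> W" "s2 ` W \<subseteq> W" "s1 ` W \<subseteq> W" for W
  proof -
    have t_eq: "t0 v = T0 *s v - s0 v" "t1 v = T1 *s v - s1 v" "t2 v = T2 *s v - s2 v" "t3 v = T3 *s v - s3 v" for v
      by (simp_all add: s_eq)
    show ?thesis
      using W by (intro irreducible) (auto simp: t_eq intro!: subspace_diff subspace_scale)
  qed
  show "diagonalizable (\<lambda>v. s1 (s0 v))" "diagonalizable (\<lambda>v. s0 (s3 v))"
    using diagonalizable_inverse[OF diagonalizable_Y linear_compose[OF linear_s(2) linear_s(1)]]
      diagonalizable_inverse[OF diagonalizable_X linear_compose[OF linear_s(1) linear_s(4)]]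
    by (simp_all add: s_t)
qed (use q_nonzero finite_span nontrivial t_s s_t linear_s in auto)

end

text \<open>Replacing \<alpha> by its inverse exchanges the two summands, which undoes the inversion
  of \<open>q\<close>.\<close>

lemma q_Racah_seq_inverse: "q_Racah_seq (inverse q) d \<theta> \<Longrightarrow> q_Racah_seq q d \<theta>"
  unfolding q_Racah_seq_def
proof (elim exE conjE)
  fix \<alpha> assume \<alpha>: "\<alpha> \<noteq> 0"
    "\<forall>r\<le>d. \<theta> r = \<alpha> * inverse q powi (2 * int r - int d) + inverse \<alpha> * inverse q powi (int d - 2 * int r)"
  have "\<theta> r = inverse \<alpha> * q powi (2 * int r - int d) + inverse (inverse \<alpha>) * q powi (int d - 2 * int r)"
    if "r \<le> d" for r
    using \<alpha>(2) that power_int_minus[of q "2 * int r - int d"] power_int_minus[of q "int d - 2 * int r"]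
    by (simp add: power_int_inverse)
  then show "\<exists>\<alpha>. \<alpha> \<noteq> 0 \<and>
      (\<forall>r\<le>d. \<theta> r = \<alpha> * q powi (2 * int r - int d) + inverse \<alpha> * q powi (int d - 2 * int r))"
    using \<alpha>(1) by (intro exI[of _ "inverse \<alpha>"]) auto
qed

lemma (in daha_operators) Leonard_pair_eigenspace:
  fixes k k' :: 'f
  defines "E \<equiv> eigenspace t0 k"
    and "A \<equiv> \<lambda>v. t0 (t1 v) + s1 (s0 v)" and "B \<equiv> \<lambda>v. t3 (t0 v) + s0 (s3 v)"
  assumes "\<exists>v. v \<noteq> 0 \<and> t0 v = k *s v" "\<exists>v. v \<noteq> 0 \<and> t0 v = k' *s v" "k \<noteq> k'"
  shows "Leonard_pair E A B \<and> q_Racah_type q E A B"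
proof -
  have eigen: "x \<noteq> 0 \<and> T0 = x + inverse x" "s0 v = inverse x *s v" if "v \<noteq> 0" "t0 v = x *s v" for v x
  proof -
    interpret s0: Vector_Spaces.linear scale scale s0 by (rule linear_s)
    have v: "v = x *s s0 v"
      using s_t(1)[of v] that by (simp add: s0.scale)
    then have x: "x \<noteq> 0"
      using that(1) by auto
    have "inverse x *s v = inverse x *s x *s s0 v"
      using v by metis
    with x show s0: "s0 v = inverse x *s v"
      by simp
    have "T0 *s v = (x + inverse x) *s v"
      using t_plus_s(1)[of v] that s0 by (simp add: scale_left_distrib)
    with x that(1) show "x \<noteq> 0 \<and> T0 = x + inverse x"
      by simp
  qed
  have k: "k \<noteq> 0" "T0 = k + inverse k" and k': "k' \<noteq> 0" "T0 = k' + inverse k'"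
    using assms(4,5) eigen(1) by blast+
  \<comment> \<open>Both eigenvalues are roots of \<open>x^2 - T0 x + 1\<close>; if
    \<open>k = inverse k\<close>, then \<open>k\<close> is a double root and equals
    \<open>k'\<close>.\<close>
  have k_inverse: "k \<noteq> inverse k"
  proof
    assume "k = inverse k"
    then have "k * k = 1"
      using k(1) by (metis right_inverse)
    moreover have "k + k = k' + inverse k'"
      using k(2) k'(2) \<open>k = inverse k\<close> by simp
    then have "(k + k) * k' = k' * k' + 1"
      using k'(1) by (simp add: distrib_right)
    ultimately have "(k - k') * (k - k') = 0"
      by (simp add: algebra_simps)
    then show False
      using assms(6) by simp
  qed
  have E_dual: "E = eigenspace s0 (inverse k)"
  proof -
    have "t0 v = k *s v \<longleftrightarrow> s0 v = inverse k *s v" for v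
      unfolding s_eq(1) k(2) by (auto simp: scale_left_distrib algebra_simps)
    then show ?thesis
      by (simp add: E_def eigenspace_def)
  qed
  interpret X: XT_operators scale q T0 T1 T2 T3 t0 t1 "\<lambda>v. t3 (t0 v)" "\<lambda>v. s0 (s3 v)"
    by (rule XT_operators)
  interpret dual: daha_operators scale "inverse q" T0 T3 T2 T1 s0 s3 s2 s1 t0 t3 t2 t1
    by (rule dual)
  interpret Y: XT_operators scale "inverse q" T0 T3 T2 T1 s0 s3 "\<lambda>v. s1 (s0 v)" "\<lambda>v. t0 (t1 v)"
    by (rule dual.XT_operators)
  \<comment> \<open>The first form is the tridiagonal operator of the original setting; the other
    two are the tridiagonal and the diagonal operator of the dual one.\<close>
  have A: "A = (\<lambda>v. t0 (t1 v) + (T1 *s (T0 *s v - t0 v) - t1 (T0 *s v - t0 v)))"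
    "B = (\<lambda>v. s0 (s3 v) + (T3 *s (T0 *s v - s0 v) - s3 (T0 *s v - s0 v)))"
    "A = (\<lambda>v. s1 (s0 v) + t0 (t1 v))"
    unfolding A_def B_def by (auto simp: s_eq add.commute)
  note hX = X.eigenspace_Leonard[OF k k_inverse assms(4), folded E_def, folded A(1) B_def]
  have "\<exists>v. v \<noteq> 0 \<and> s0 v = inverse k *s v"
    using assms(4) eigen(2) by blast
  note hY = Y.eigenspace_Leonard[of "inverse k", folded E_dual, folded A(2,3), OF _ _ _ this]
  have AE: "A ` E \<subseteq> E" and BE: "B ` E \<subseteq> E"
    using hX(3) hY(3) k k_inverse by auto
  obtain \<theta> where \<theta>: "standard_ordering E A B \<theta>" "q_Racah_seq q (diameter E) \<theta>"
    using hX(4) by blast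
  have "\<exists>\<theta>. standard_ordering E B A \<theta> \<and> q_Racah_seq (inverse q) (diameter E) \<theta>"
    using hY(4) k k_inverse by (auto simp: add.commute)
  then obtain \<theta>' where \<theta>': "standard_ordering E B A \<theta>'" "q_Racah_seq q (diameter E) \<theta>'"
    using q_Racah_seq_inverse by blast
  have "subspace E"
    by (metis hX(1) subspace_span)
  moreover have "endo_on E A" "endo_on E B"
    using AE BE linear_s unfolding endo_on_def A_def B_def
    by (auto simp: Vector_Spaces.linear_iff t0.add t1.add t3.add t0.scale t1.scale t3.scale scale_right_distrib)
  ultimately have "Leonard_pair E A B"
    using hX(1,2) \<theta>(1) \<theta>'(1) unfolding Leonard_pair_def standard_ordering_def by blast
  moreover have "q_Racah_type q E A B"
    unfolding q_Racah_type_def using \<theta> \<theta>' by blast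
  ultimately show ?thesis ..
qed

section \<open>The action of the algebra\<close>

lemma ring_hom_daha_class: "daha_class q \<in> ring_hom free_alg (DAHA q)"
  unfolding daha_class_def[abs_def] DAHA_def by (rule ideal.rcos_ring_hom[OF ideal_daha_ideal])

lemma daha_class_closed: "daha_class q x \<in> carrier (DAHA q)"
  using ring_hom_closed[OF ring_hom_daha_class] by (simp add: free_alg_def)

lemma daha_class_add: "daha_class q (x + y) = daha_class q x \<oplus>\<^bsub>DAHA q\<^esub> daha_class q y"
  using ring_hom_add[OF ring_hom_daha_class, of x y] by (simp add: free_alg_def)

lemma daha_class_mult: "daha_class q (x * y) = daha_class q x \<otimes>\<^bsub>DAHA q\<^esub> daha_class q y"
  using ring_hom_mult[OF ring_hom_daha_class, of x y] by (simp add: free_alg_def)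

lemma daha_class_one: "daha_class q 1 = \<one>\<^bsub>DAHA q\<^esub>"
  using ring_hom_one[OF ring_hom_daha_class] by (simp add: free_alg_def)

lemma carrier_DAHA: "carrier (DAHA q) = range (daha_class q)"
  by (auto simp: DAHA_def FactRing_def A_RCOSETS_def' daha_class_def free_alg_def)

lemma daha_class_eqI:
  assumes "x - y \<in> daha_relations q"
  shows "daha_class q x = daha_class q y"
proof -
  interpret ideal "daha_ideal q" free_alg by (rule ideal_daha_ideal)
  interpret D: ring "DAHA q" by (rule ring_DAHA)
  have "x - y \<in> daha_ideal q"
    unfolding daha_ideal_def using assms ring.genideal_self[OF ring_free_alg, of "daha_relations q"]
    by (auto simp: free_alg_def)
  then have "daha_class q (x - y) = \<zero>\<^bsub>DAHA q\<^esub>"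
    unfolding daha_class_def by (simp add: a_rcos_const DAHA_def FactRing_def)
  then show ?thesis
    using daha_class_add[of q "x - y" y] daha_class_closed[of q y] by simp
qed

text \<open>Every element is a finite sum of scalar multiples of words, and words are products of
  letters.\<close>

lemma daha_free_induct:
  fixes x :: "('f::field) daha_free"
  assumes add: "\<And>x y. Q x \<Longrightarrow> Q y \<Longrightarrow> Q (x + y)" and mult: "\<And>x y. Q x \<Longrightarrow> Q y \<Longrightarrow> Q (x * y)"
    and const: "\<And>c. Q (free_const c)" and gen: "\<And>i. Q (free_gen i)" "\<And>i. Q (free_gen_inv i)"
  shows "Q x"
proof -
  have letter: "Q (Poly_Mapping.single (Word [l]) 1)" for l
    using gen by (cases l) (auto simp: free_gen_def free_gen_inv_def)
  have word: "Q (Poly_Mapping.single (Word ls) 1)" for ls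
  proof (induction ls)
    case Nil
    then show ?case
      using const[of 1] by (simp add: free_const_def zero_daha_word_def)
  next
    case (Cons l ls)
    then show ?case
      using mult[OF letter[of l] Cons] by (simp add: mult_single plus_daha_word_def)
  qed
  have single: "Q (Poly_Mapping.single u c)" for u c
    using mult[OF const[of c] word[of "letters u"]] by (simp add: free_const_def mult_single)
  show ?thesis
  proof (induction x rule: update_induct)
    case const
    then show ?case
      using single[of 0 0] by simp
  next
    case (update f a b)
    have "Poly_Mapping.update a b f = f + Poly_Mapping.single a b"
      using update.hyps(1) by (intro poly_mapping_eqI)
        (auto simp: lookup_update lookup_add lookup_single in_keys_iff when_def)
    then show ?case
      using add[OF update.IH single] by simp
  qed
qed

context DAHA_module
begin

text \<open>The action pulled back along the quotient map, so that computations take place in the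
  free algebra instead of with cosets.\<close>

definition op :: "'f daha_free \<Rightarrow> 'v \<Rightarrow> 'v" where
  "op x = act (daha_class q x)"

lemma op_add: "op (x + y) v = op x v + op y v"
  by (simp add: op_def daha_class_add act_add daha_class_closed)

lemma op_mult: "op (x * y) v = op x (op y v)"
  by (simp add: op_def daha_class_mult act_mult daha_class_closed)

lemma op_one: "op 1 v = v"
  by (simp add: op_def daha_class_one act_one)

lemma op_const: "op (free_const c) v = c *s v"
  using act_const by (simp add: op_def daha_const_def)

lemma linear_op: "Vector_Spaces.linear scale scale (op x)"
  unfolding Vector_Spaces.linear_iff
  by (simp add: op_def act_add_right act_scale daha_class_closed vector_space_axioms)

lemma op_eqI: "x - y \<in> daha_relations q \<Longrightarrow> op x = op y"
  by (simp add: op_def daha_class_eqI)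

lemma op_gen_inverse: "op (free_gen i) (op (free_gen_inv i) v) = v"
  "op (free_gen_inv i) (op (free_gen i) v) = v"
proof -
  have "op (free_gen i * free_gen_inv i) = op 1" "op (free_gen_inv i * free_gen i) = op 1"
    by (rule op_eqI; force simp: daha_relations_def)+
  then show "op (free_gen i) (op (free_gen_inv i) v) = v" "op (free_gen_inv i) (op (free_gen i) v) = v"
    by (simp_all add: op_mult[symmetric] op_one)
qed

lemma op_product:
  "op (free_gen I0) (op (free_gen I1) (op (free_gen I2) (op (free_gen I3) v))) = inverse q *s v"
proof -
  have "op (free_gen I0 * free_gen I1 * free_gen I2 * free_gen I3) = op (free_const (inverse q))"
    by (rule op_eqI) (simp add: daha_relations_def)
  from fun_cong[OF this, of v] show ?thesis
    by (simp add: op_mult op_const)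
qed

lemma op_central:
  "op (free_gen i + free_gen_inv i) (op x v) = op x (op (free_gen i + free_gen_inv i) v)"
proof -
  have "op ((free_gen i + free_gen_inv i) * x) = op (x * (free_gen i + free_gen_inv i))"
    by (rule op_eqI) (auto simp: daha_relations_def)
  then show ?thesis
    unfolding op_mult[symmetric] by simp
qed

lemma op_invariant:
  assumes "subspace W" "\<And>i v. v \<in> W \<Longrightarrow> op (free_gen i) v \<in> W" "\<And>i v. v \<in> W \<Longrightarrow> op (free_gen_inv i) v \<in> W"
    and "v \<in> W"
  shows "op x v \<in> W"
proof -
  have "\<forall>v\<in>W. op x v \<in> W"
    using assms(1-3) by (induction x rule: daha_free_induct)
      (auto simp: op_add op_mult op_const subspace_add subspace_scale)
  with assms(4) show ?thesis by blast
qed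

lemma invariant_subspace_trivial:
  assumes "irreducible_module" "subspace W" "\<And>x v. v \<in> W \<Longrightarrow> op x v \<in> W"
  shows "W = {0} \<or> W = UNIV"
  using assms unfolding irreducible_module_def carrier_DAHA op_def by blast

lemma act_daha_generators:
  "act (daha_t q i) = op (free_gen i)"
  "act (daha_X q) = (\<lambda>v. op (free_gen I3) (op (free_gen I0) v))"
  "act (daha_Y q) = (\<lambda>v. op (free_gen I0) (op (free_gen I1) v))"
  "act (daha_A q) = (\<lambda>v. op (free_gen I0) (op (free_gen I1) v) + op (free_gen_inv I1) (op (free_gen_inv I0) v))"
  "act (daha_B q) = (\<lambda>v. op (free_gen I3) (op (free_gen I0) v) + op (free_gen_inv I0) (op (free_gen_inv I3) v))"
proof -
  interpret D: ring "DAHA q" by (rule ring_DAHA)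
  show t: "act (daha_t q i) = op (free_gen i)" for i
    by (simp add: op_def daha_t_def)
  have XY: "daha_X q = daha_class q (free_gen I3 * free_gen I0)" "daha_Y q = daha_class q (free_gen I0 * free_gen I1)"
    by (simp_all add: daha_X_def daha_Y_def daha_t_def daha_class_mult)
  then show "act (daha_X q) = (\<lambda>v. op (free_gen I3) (op (free_gen I0) v))"
    "act (daha_Y q) = (\<lambda>v. op (free_gen I0) (op (free_gen I1) v))"
    by (auto simp: op_mult simp flip: op_def)
  have class_inv: "daha_class q (free_gen i) \<otimes>\<^bsub>DAHA q\<^esub> daha_class q (free_gen_inv i) = \<one>\<^bsub>DAHA q\<^esub>"
    "daha_class q (free_gen_inv i) \<otimes>\<^bsub>DAHA q\<^esub> daha_class q (free_gen i) = \<one>\<^bsub>DAHA q\<^esub>" for i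
    unfolding daha_class_mult[symmetric] daha_class_one[symmetric]
    by (rule daha_class_eqI; force simp: daha_relations_def)+
  have inv: "inv\<^bsub>DAHA q\<^esub> (daha_class q (free_gen i * free_gen j)) = daha_class q (free_gen_inv j * free_gen_inv i)"
    for i j
  proof (rule D.inv_unique'[symmetric])
    show "daha_class q (free_gen i * free_gen j) \<otimes>\<^bsub>DAHA q\<^esub> daha_class q (free_gen_inv j * free_gen_inv i) = \<one>\<^bsub>DAHA q\<^esub>"
      by (metis D.m_assoc D.r_one class_inv(1) daha_class_closed daha_class_mult)
    show "daha_class q (free_gen_inv j * free_gen_inv i) \<otimes>\<^bsub>DAHA q\<^esub> daha_class q (free_gen i * free_gen j) = \<one>\<^bsub>DAHA q\<^esub>"
      by (metis D.m_assoc D.r_one class_inv(2) daha_class_closed daha_class_mult)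
  qed (rule daha_class_closed)+
  show "act (daha_A q) = (\<lambda>v. op (free_gen I0) (op (free_gen I1) v) + op (free_gen_inv I1) (op (free_gen_inv I0) v))"
    "act (daha_B q) = (\<lambda>v. op (free_gen I3) (op (free_gen I0) v) + op (free_gen_inv I0) (op (free_gen_inv I3) v))"
    unfolding daha_A_def daha_B_def XY inv daha_class_add[symmetric] op_def[symmetric] op_add op_mult by auto
qed

end

text \<open>An eigenspace of a central element is a submodule, and algebraic closedness supplies a
  nonzero one.\<close>

lemma central_sum_scalar:
  fixes scale :: "'f::alg_closed_field \<Rightarrow> 'v::ab_group_add \<Rightarrow> 'v"
  assumes "feasible_DAHA_module scale q act"
  shows "\<exists>c. \<forall>v. act (daha_class q (free_gen i + free_gen_inv i)) v = scale c v"
proof -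
  interpret feasible_DAHA_module scale q act by (rule assms)
  let ?f = "op (free_gen i + free_gen_inv i)"
  interpret f: Vector_Spaces.linear scale scale ?f by (rule linear_op)
  obtain S where S: "finite S" "span S = UNIV"
    using finite_dim by blast
  obtain v :: 'v where "v \<noteq> 0"
    using irreducible unfolding irreducible_module_def by blast
  then obtain c w where w: "w \<noteq> 0" "?f w = scale c w"
    using exists_eigenvector[OF linear_op S] by metis
  have "eigenspace ?f c = {0} \<or> eigenspace ?f c = UNIV"
  proof (rule invariant_subspace_trivial[OF irreducible])
    show "subspace (eigenspace ?f c)"
      by (rule subspaceI) (auto simp: eigenspace_def f.zero f.add f.scale scale_right_distrib mult.commute)
    fix x v assume "v \<in> eigenspace ?f c"
    then show "op x v \<in> eigenspace ?f c"
      using linear_op[of x] by (simp add: eigenspace_def op_central Vector_Spaces.linear_iff)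
  qed
  moreover have "w \<in> eigenspace ?f c"
    using w by (simp add: eigenspace_def)
  ultimately have "eigenspace ?f c = UNIV"
    using w(1) by auto
  then show ?thesis
    by (auto simp: eigenspace_def op_def)
qed

theorem theorem1p7:
  fixes q :: "'f::alg_closed_field"
    and scale :: "'f \<Rightarrow> 'v::ab_group_add \<Rightarrow> 'v"
    and act :: "'f daha_free set \<Rightarrow> 'v \<Rightarrow> 'v"
  assumes "q \<noteq> 0"
    and "\<And>n::nat. n > 0 \<Longrightarrow> q ^ n \<noteq> 1"
    and "feasible_DAHA_module scale q act"
    and "\<theta> \<in> vector_space.eigenvalues_on scale UNIV (act (daha_t q I0))"
  shows "vector_space.Leonard_pair scale
           (vector_space.eigenspace scale (act (daha_t q I0)) \<theta>) (act (daha_A q)) (act (daha_B q))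
       \<and> vector_space.q_Racah_type scale q
           (vector_space.eigenspace scale (act (daha_t q I0)) \<theta>) (act (daha_A q)) (act (daha_B q))"
proof -
  interpret feasible_DAHA_module scale q act by (rule assms(3))
  obtain T where T: "\<And>i v. op (free_gen i) v + op (free_gen_inv i) v = scale (T i) v"
    using central_sum_scalar[OF assms(3)] unfolding op_def[symmetric] op_add by metis
  interpret daha_operators scale q "T I0" "T I1" "T I2" "T I3"
    "op (free_gen I0)" "op (free_gen I1)" "op (free_gen I2)" "op (free_gen I3)"
    "op (free_gen_inv I0)" "op (free_gen_inv I1)" "op (free_gen_inv I2)" "op (free_gen_inv I3)"
  proof (intro daha_operators.intro daha_operators_axioms.intro vector_space_axioms)
    show "\<exists>v::'v. v \<noteq> 0"
      using irreducible unfolding irreducible_module_def by blast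
    show "W = {0} \<or> W = UNIV"
      if W: "subspace W" "op (free_gen I0) ` W \<subseteq> W" "op (free_gen I1) ` W \<subseteq> W"
        "op (free_gen I2) ` W \<subseteq> W" "op (free_gen I3) ` W \<subseteq> W" for W
    proof (rule invariant_subspace_trivial[OF irreducible W(1)])
      have gen: "op (free_gen i) v \<in> W" if "v \<in> W" for i v
        using W(2-5) that by (cases i) auto
      \<comment> \<open>The inverses are linear in the generators, so invariance under the four
        generators extends to the whole algebra.\<close>
      have "op (free_gen_inv i) v = scale (T i) v - op (free_gen i) v" for i v
        using T[of i v] by (simp add: eq_diff_eq add.commute)
      then have "op (free_gen_inv i) v \<in> W" if "v \<in> W" for i v
        using gen that W(1) by (simp add: subspace_diff subspace_scale)
      then show "op x v \<in> W" if "v \<in> W" for x v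
        using op_invariant[OF W(1) gen _ that] by blast
    qed
  qed (use assms(1,2) T finite_dim diagonalizable_X diagonalizable_Y linear_op op_gen_inverse op_product
      in \<open>auto simp: act_daha_generators\<close>)
  \<comment> \<open>The second eigenvalue of \<open>t0\<close> is what excludes
    \<open>\<theta> = inverse \<theta>\<close>.\<close>
  have "card (eigenvalues_on UNIV (act (daha_t q I0)) - {\<theta>}) = 1"
    using two_eigenvalues assms(4) by simp
  then obtain \<theta>' where "\<theta>' \<in> eigenvalues_on UNIV (act (daha_t q I0))" "\<theta> \<noteq> \<theta>'"
    by (metis card_1_singletonE DiffE insertI1 singletonI)
  with assms(4) show ?thesis
    unfolding act_daha_generators
    by (intro Leonard_pair_eigenspace[of _ \<theta>']) (auto simp: eigenvalues_on_def)
qed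

end
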